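(* Let $M^m$ be an $m$-dimensional pseudo-umbilical submanifold of the unit Euclidean sphere $\mathbb{S}^{m+2}$, with $m\neq 4$. Then $M$ is proper biharmonic in $\mathbb{S}^{m+2}$ if and only if it is minimal in $\mathbb{S}^{m+1}\big(\tfrac1{\sqrt2}\big)$, i.e. $M$ is a minimal submanifold of a hypersphere $\mathbb{S}^{m+1}\big(\tfrac1{\sqrt2}\big)\subset\mathbb{S}^{m+2}$ of radius $\tfrac1{\sqrt2}$.
   Context: For a smooth map $\phi:(M,g)\to(N,h)$ between Riemannian manifolds, the tension field is $\tau(\phi)=\operatorname{trace}\nabla d\phi$ and the bitension field is $\tau_2(\phi)=-\Delta\tau(\phi)-\operatorname{trace}R^N(d\phi,\tau(\phi))d\phi$, where $\Delta=-\operatorname{trace}\nabla^2$ is the rough Laplacian on sections of $\phi^{-1}TN$ and $R^N(X,Y)=[\nabla_X,\nabla_Y]-\nabla_{[X,Y]}$ is the curvature of $N$. The map $\phi$ is harmonic if $\tau(\phi)=0$, biharmonic if $\tau_2(\phi)=0$, and proper biharmonic if it is biharmonic and not harmonic. A submanifold $M$ of $N$ (with the induced metric) is called biharmonic (resp. proper biharmonic) if its inclusion map is biharmonic (resp. proper biharmonic); the inclusion is harmonic exactly when $M$ is minimal. The mean curvature vector field of $M^m$ is $H=\frac1m\operatorname{trace}B$, with $B$ the second fundamental form. A submanifold $M$ of a Riemannian manifold $N$ is pseudo-umbilical if there is a function $\lambda\in C^\infty(M)$ such that $A_H=\lambda\operatorname{Id}$, where $A_H$ is the Weingarten (shape) operator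 associated to $H$. A hypersphere $\mathbb{S}^{m+1}(r)\subset\mathbb{S}^{m+2}$ of radius $r$ is an intersection of $\mathbb{S}^{m+2}\subset\mathbb{R}^{m+3}$ with an affine hyperplane that is a Euclidean sphere of radius $r$.
   Formalization: M is assumed nonempty, connected and of dimension m ≥ 2: for m = 1 non-circular helices of S^3 with k²+t²=1 are proper biharmonic counterexamples, and a union of a piece of a great sphere and a minimal piece of S^{m+1}(1/√2) is a disconnected one. *)

theory Defs
  imports "HOL-Analysis.Analysis"
begin

section \<open>Smooth maps between Euclidean spaces\<close>

text \<open>\<open>Ck_on k f S\<close> and \<open>smooth_on f S\<close> are meant for open \<open>S\<close>.\<close>

primrec Ck_on ::
  "nat \<Rightarrow> ('a::euclidean_space \<Rightarrow> 'b::real_normed_vector) \<Rightarrow> 'a set \<Rightarrow> bool" where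
  "Ck_on 0 f S \<longleftrightarrow> continuous_on S f"
| "Ck_on (Suc k) f S \<longleftrightarrow>
     (\<forall>x\<in>S. f differentiable (at x)) \<and> (\<forall>v. Ck_on k (\<lambda>x. frechet_derivative f (at x) v) S)"

definition smooth_on :: "('a::euclidean_space \<Rightarrow> 'b::real_normed_vector) \<Rightarrow> 'a set \<Rightarrow> bool" where
  "smooth_on f S \<longleftrightarrow> (\<forall>k. Ck_on k f S)"

definition pd :: "'m::finite \<Rightarrow> (real ^ 'm \<Rightarrow> 'b::real_normed_vector) \<Rightarrow> real ^ 'm \<Rightarrow> 'b" where
  "pd i f p = frechet_derivative f (at p) (axis i 1)"


section \<open>The target: a submanifold \<open>N\<close> of a Euclidean space with its induced metric\<close>

text \<open>
  Target manifolds are subsets \<open>N\<close> of a Euclidean space \<open>'e\<close> that are embedded submanifolds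
  (the unit sphere and hyperspheres of it, below), with the induced metric. Their
  Levi-Civita connection is the orthogonal projection to the tangent spaces of \<open>N\<close> of the
  derivative in \<open>'e\<close>.
\<close>

definition tangent_space :: "'e::euclidean_space set \<Rightarrow> 'e \<Rightarrow> 'e set" where
  "tangent_space N q =
     {v. \<exists>\<gamma> :: real \<Rightarrow> 'e. \<exists>e>0. (\<forall>t. \<bar>t\<bar> < e \<longrightarrow> \<gamma> t \<in> N) \<and> \<gamma> 0 = q \<and>
         (\<gamma> has_vector_derivative v) (at 0)}"

definition orth_proj :: "'e::euclidean_space set \<Rightarrow> 'e \<Rightarrow> 'e" where
  "orth_proj V v = (THE w. w \<in> V \<and> (\<forall>u\<in>V. (v - w) \<bullet> u = 0))"

text \<open>
  Vector fields on \<open>N\<close> are functions \<open>'e \<Rightarrow> 'e\<close> of which only the values on \<open>N\<close> matter.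
  A derivative within \<open>N\<close> is not unique as a linear map on \<open>'e\<close>, but its values on vectors
  tangent to \<open>N\<close> are.
\<close>

definition deriv_along :: "'e::euclidean_space set \<Rightarrow> ('e \<Rightarrow> 'e) \<Rightarrow> 'e \<Rightarrow> 'e \<Rightarrow> 'e" where
  "deriv_along N Y q v = (THE w. \<exists>D. (Y has_derivative D) (at q within N) \<and> D v = w)"

definition nabla ::
  "'e::euclidean_space set \<Rightarrow> ('e \<Rightarrow> 'e) \<Rightarrow> ('e \<Rightarrow> 'e) \<Rightarrow> 'e \<Rightarrow> 'e" where
  "nabla N X Y q = orth_proj (tangent_space N q) (deriv_along N Y q (X q))"

definition lie_bracket ::
  "'e::euclidean_space set \<Rightarrow> ('e \<Rightarrow> 'e) \<Rightarrow> ('e \<Rightarrow> 'e) \<Rightarrow> 'e \<Rightarrow> 'e" where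
  "lie_bracket N X Y q = deriv_along N Y q (X q) - deriv_along N X q (Y q)"

definition curvature_op ::
  "'e::euclidean_space set \<Rightarrow> ('e \<Rightarrow> 'e) \<Rightarrow> ('e \<Rightarrow> 'e) \<Rightarrow> ('e \<Rightarrow> 'e) \<Rightarrow> 'e \<Rightarrow> 'e" where
  "curvature_op N X Y Z q =
     nabla N X (nabla N Y Z) q - nabla N Y (nabla N X Z) q - nabla N (lie_bracket N X Y) Z q"

text \<open>
  The curvature is tensorial, so its value on tangent vectors \<open>u\<close>, \<open>v\<close>, \<open>w\<close> at \<open>q\<close> may be
  computed with any tangent fields extending them; the fields chosen here are the tangential
  parts of the constant fields.
\<close>

definition tangent_ext :: "'e::euclidean_space set \<Rightarrow> 'e \<Rightarrow> 'e \<Rightarrow> 'e" where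
  "tangent_ext N u = (\<lambda>q. orth_proj (tangent_space N q) u)"

definition riemann :: "'e::euclidean_space set \<Rightarrow> 'e \<Rightarrow> 'e \<Rightarrow> 'e \<Rightarrow> 'e \<Rightarrow> 'e" where
  "riemann N q u v w = curvature_op N (tangent_ext N u) (tangent_ext N v) (tangent_ext N w) q"


section \<open>Tension and bitension field in local coordinates\<close>

text \<open>
  Here \<open>g\<close> is the coordinate matrix of a Riemannian metric on an open subset of \<open>real ^ 'm\<close>
  and \<open>f\<close> is a map from that open subset to \<open>N\<close>.
\<close>

definition christoffel ::
  "(real ^ 'm \<Rightarrow> real ^ 'm ^ 'm) \<Rightarrow> real ^ 'm \<Rightarrow> 'm \<Rightarrow> 'm \<Rightarrow> 'm::finite \<Rightarrow> real" where
  "christoffel g p k i j =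
     1/2 * (\<Sum>l\<in>UNIV. matrix_inv (g p) $ k $ l *
       (pd i (\<lambda>q. g q $ j $ l) p + pd j (\<lambda>q. g q $ i $ l) p - pd l (\<lambda>q. g q $ i $ j) p))"

definition metric_trace ::
  "(real ^ 'm \<Rightarrow> real ^ 'm ^ 'm) \<Rightarrow> real ^ 'm \<Rightarrow> ('m \<Rightarrow> 'm::finite \<Rightarrow> 'e::real_vector) \<Rightarrow> 'e" where
  "metric_trace g p T = (\<Sum>i\<in>UNIV. \<Sum>j\<in>UNIV. (matrix_inv (g p) $ i $ j) *\<^sub>R T i j)"

text \<open>
  \<open>pullback_nabla N f i V\<close> is the covariant derivative in the coordinate direction \<open>i\<close>, for the
  connection that \<open>f\<close> pulls back from \<open>N\<close>, of a section \<open>V\<close> of \<open>f\<inverse>TN\<close>.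
\<close>

definition pullback_nabla ::
  "'e::euclidean_space set \<Rightarrow> (real ^ 'm \<Rightarrow> 'e) \<Rightarrow> 'm::finite \<Rightarrow>
   (real ^ 'm \<Rightarrow> 'e) \<Rightarrow> real ^ 'm \<Rightarrow> 'e" where
  "pullback_nabla N f i V p = orth_proj (tangent_space N (f p)) (pd i V p)"

definition nabla_d ::
  "'e::euclidean_space set \<Rightarrow> (real ^ 'm \<Rightarrow> real ^ 'm ^ 'm) \<Rightarrow> (real ^ 'm \<Rightarrow> 'e) \<Rightarrow>
   real ^ 'm \<Rightarrow> 'm \<Rightarrow> 'm::finite \<Rightarrow> 'e" where
  "nabla_d N g f p i j =
     pullback_nabla N f i (pd j f) p - (\<Sum>k\<in>UNIV. christoffel g p k i j *\<^sub>R pd k f p)"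

definition tension ::
  "'e::euclidean_space set \<Rightarrow> (real ^ 'm \<Rightarrow> real ^ 'm ^ 'm) \<Rightarrow> (real ^ 'm \<Rightarrow> 'e) \<Rightarrow>
   real ^ 'm::finite \<Rightarrow> 'e" where
  "tension N g f p = metric_trace g p (nabla_d N g f p)"

definition nabla2 ::
  "'e::euclidean_space set \<Rightarrow> (real ^ 'm \<Rightarrow> real ^ 'm ^ 'm) \<Rightarrow> (real ^ 'm \<Rightarrow> 'e) \<Rightarrow>
   (real ^ 'm \<Rightarrow> 'e) \<Rightarrow> real ^ 'm \<Rightarrow> 'm \<Rightarrow> 'm::finite \<Rightarrow> 'e" where
  "nabla2 N g f V p i j =
     pullback_nabla N f i (pullback_nabla N f j V) p
     - (\<Sum>k\<in>UNIV. christoffel g p k i j *\<^sub>R pullback_nabla N f k V p)"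

definition rough_laplacian ::
  "'e::euclidean_space set \<Rightarrow> (real ^ 'm \<Rightarrow> real ^ 'm ^ 'm) \<Rightarrow> (real ^ 'm \<Rightarrow> 'e) \<Rightarrow>
   (real ^ 'm \<Rightarrow> 'e) \<Rightarrow> real ^ 'm::finite \<Rightarrow> 'e" where
  "rough_laplacian N g f V p = - metric_trace g p (nabla2 N g f V p)"

definition bitension ::
  "'e::euclidean_space set \<Rightarrow> (real ^ 'm \<Rightarrow> real ^ 'm ^ 'm) \<Rightarrow> (real ^ 'm \<Rightarrow> 'e) \<Rightarrow>
   real ^ 'm::finite \<Rightarrow> 'e" where
  "bitension N g f p =
     - rough_laplacian N g f (tension N g f) p
     - metric_trace g p (\<lambda>i j. riemann N (f p) (pd i f p) (tension N g f p) (pd j f p))"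


section \<open>Submanifold geometry in local coordinates\<close>

text \<open>
  Here \<open>x\<close> is a local parametrization of a submanifold of \<open>N\<close>. The second fundamental form,
  the mean curvature field and the shape operator are those of the submanifold in \<open>N\<close>
  (not in the ambient Euclidean space).
\<close>

definition induced_metric ::
  "(real ^ 'm \<Rightarrow> 'e::euclidean_space) \<Rightarrow> real ^ 'm::finite \<Rightarrow> real ^ 'm ^ 'm" where
  "induced_metric x p = (\<chi> i j. pd i x p \<bullet> pd j x p)"

definition tangent_image ::
  "(real ^ 'm \<Rightarrow> 'e::euclidean_space) \<Rightarrow> real ^ 'm::finite \<Rightarrow> 'e set" where
  "tangent_image x p = range (frechet_derivative x (at p))"

definition second_ff ::
  "'e::euclidean_space set \<Rightarrow> (real ^ 'm \<Rightarrow> 'e) \<Rightarrow> real ^ 'm \<Rightarrow> 'm \<Rightarrow> 'm::finite \<Rightarrow> 'e" where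
  "second_ff N x p i j =
     pullback_nabla N x i (pd j x) p
     - orth_proj (tangent_image x p) (pullback_nabla N x i (pd j x) p)"

definition mean_curvature ::
  "'e::euclidean_space set \<Rightarrow> (real ^ 'm \<Rightarrow> 'e) \<Rightarrow> real ^ 'm::finite \<Rightarrow> 'e" where
  "mean_curvature N x p =
     (1 / real CARD('m)) *\<^sub>R metric_trace (induced_metric x) p (second_ff N x p)"

text \<open>
  Weingarten formula: for a normal field \<open>\<xi>\<close>, \<open>shape_op N x \<xi> p v\<close> is the vector
  \<open>A\<^sub>\<xi> (dx v)\<close>, i.e. minus the tangential part of the covariant derivative in \<open>N\<close> of \<open>\<xi>\<close>
  in the direction \<open>dx v\<close>.
\<close>

definition shape_op ::
  "'e::euclidean_space set \<Rightarrow> (real ^ 'm \<Rightarrow> 'e) \<Rightarrow> (real ^ 'm \<Rightarrow> 'e) \<Rightarrow>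
   real ^ 'm \<Rightarrow> real ^ 'm::finite \<Rightarrow> 'e" where
  "shape_op N x \<xi> p v =
     - orth_proj (tangent_image x p)
         (orth_proj (tangent_space N (x p)) (frechet_derivative \<xi> (at p) v))"


section \<open>Smooth manifolds and their immersions\<close>

text \<open>
  A chart is a pair \<open>(U, \<chi>)\<close> of a domain and a coordinate map; only the values of \<open>\<chi>\<close> on \<open>U\<close>
  matter. The atlas is not required to be maximal.
\<close>

type_synonym ('a, 'm) chart = "'a set \<times> ('a \<Rightarrow> real ^ 'm)"

definition chart_image :: "('a, 'm::finite) chart \<Rightarrow> (real ^ 'm) set" where
  "chart_image c = snd c ` fst c"

definition in_chart :: "('a, 'm::finite) chart \<Rightarrow> ('a \<Rightarrow> 'b) \<Rightarrow> real ^ 'm \<Rightarrow> 'b" where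
  "in_chart c f = f \<circ> inv_into (fst c) (snd c)"

definition smooth_manifold :: "'a topology \<Rightarrow> ('a, 'm::finite) chart set \<Rightarrow> bool" where
  "smooth_manifold T \<A> \<longleftrightarrow>
     Hausdorff_space T \<and> second_countable T \<and>
     (\<Union>c\<in>\<A>. fst c) = topspace T \<and>
     (\<forall>c\<in>\<A>. openin T (fst c) \<and> open (chart_image c) \<and>
        homeomorphic_map (subtopology T (fst c)) (top_of_set (chart_image c)) (snd c)) \<and>
     (\<forall>c\<in>\<A>. \<forall>d\<in>\<A>. smooth_on (in_chart c (snd d)) (snd c ` (fst c \<inter> fst d)))"

definition smooth_map ::
  "('a, 'm::finite) chart set \<Rightarrow> ('a \<Rightarrow> 'e::real_normed_vector) \<Rightarrow> bool" where
  "smooth_map \<A> f \<longleftrightarrow> (\<forall>c\<in>\<A>. smooth_on (in_chart c f) (chart_image c))"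

definition immersion ::
  "('a, 'm::finite) chart set \<Rightarrow> ('a \<Rightarrow> 'e::euclidean_space) \<Rightarrow> bool" where
  "immersion \<A> \<phi> \<longleftrightarrow> smooth_map \<A> \<phi> \<and>
     (\<forall>c\<in>\<A>. \<forall>p\<in>chart_image c. inj (frechet_derivative (in_chart c \<phi>) (at p)))"

text \<open>
  A submanifold of \<open>N\<close> is a smooth manifold together with an immersion \<open>\<phi>\<close> into \<open>N\<close>.
  An embedded submanifold is the case where \<open>\<phi>\<close> is the inclusion of a subset with the
  subspace topology.
\<close>

definition submanifold ::
  "'e::euclidean_space set \<Rightarrow> 'a topology \<Rightarrow> ('a, 'm::finite) chart set \<Rightarrow> ('a \<Rightarrow> 'e) \<Rightarrow> bool" where
  "submanifold N T \<A> \<phi> \<longleftrightarrow> smooth_manifold T \<A> \<and> immersion \<A> \<phi> \<and> \<phi> ` topspace T \<subseteq> N"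

text \<open>
  A metric on the manifold is given by its coordinate matrix \<open>G c\<close> in every chart \<open>c\<close>.
\<close>

definition harmonic_map ::
  "'e::euclidean_space set \<Rightarrow> ('a, 'm::finite) chart set \<Rightarrow>
   (('a, 'm) chart \<Rightarrow> real ^ 'm \<Rightarrow> real ^ 'm ^ 'm) \<Rightarrow> ('a \<Rightarrow> 'e) \<Rightarrow> bool" where
  "harmonic_map N \<A> G \<phi> \<longleftrightarrow>
     (\<forall>c\<in>\<A>. \<forall>p\<in>chart_image c. tension N (G c) (in_chart c \<phi>) p = 0)"

definition biharmonic_map ::
  "'e::euclidean_space set \<Rightarrow> ('a, 'm::finite) chart set \<Rightarrow>
   (('a, 'm) chart \<Rightarrow> real ^ 'm \<Rightarrow> real ^ 'm ^ 'm) \<Rightarrow> ('a \<Rightarrow> 'e) \<Rightarrow> bool" where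
  "biharmonic_map N \<A> G \<phi> \<longleftrightarrow>
     (\<forall>c\<in>\<A>. \<forall>p\<in>chart_image c. bitension N (G c) (in_chart c \<phi>) p = 0)"

definition pullback_metric ::
  "('a \<Rightarrow> 'e::euclidean_space) \<Rightarrow> ('a, 'm::finite) chart \<Rightarrow> real ^ 'm \<Rightarrow> real ^ 'm ^ 'm" where
  "pullback_metric \<phi> c = induced_metric (in_chart c \<phi>)"

definition proper_biharmonic ::
  "'e::euclidean_space set \<Rightarrow> ('a, 'm::finite) chart set \<Rightarrow> ('a \<Rightarrow> 'e) \<Rightarrow> bool" where
  "proper_biharmonic N \<A> \<phi> \<longleftrightarrow>
     biharmonic_map N \<A> (pullback_metric \<phi>) \<phi> \<and> \<not> harmonic_map N \<A> (pullback_metric \<phi>) \<phi>"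

definition minimal ::
  "'e::euclidean_space set \<Rightarrow> ('a, 'm::finite) chart set \<Rightarrow> ('a \<Rightarrow> 'e) \<Rightarrow> bool" where
  "minimal N \<A> \<phi> \<longleftrightarrow>
     (\<forall>c\<in>\<A>. \<forall>p\<in>chart_image c. mean_curvature N (in_chart c \<phi>) p = 0)"

text \<open>
  For curves (\<open>CARD('m) = 1\<close>) this condition is vacuous.
\<close>

definition pseudo_umbilical ::
  "'e::euclidean_space set \<Rightarrow> ('a, 'm::finite) chart set \<Rightarrow> ('a \<Rightarrow> 'e) \<Rightarrow> bool" where
  "pseudo_umbilical N \<A> \<phi> \<longleftrightarrow>
     (\<exists>l :: 'a \<Rightarrow> real. smooth_map \<A> l \<and>
        (\<forall>c\<in>\<A>. \<forall>p\<in>chart_image c. \<forall>v.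
           shape_op N (in_chart c \<phi>) (mean_curvature N (in_chart c \<phi>)) p v =
           in_chart c l p *\<^sub>R frechet_derivative (in_chart c \<phi>) (at p) v))"

definition hypersphere_of_unit_sphere :: "real \<Rightarrow> 'e::euclidean_space set \<Rightarrow> bool" where
  "hypersphere_of_unit_sphere r S \<longleftrightarrow>
     0 < r \<and>
     (\<exists>a b z. a \<noteq> 0 \<and> a \<bullet> z = b \<and>
        S = sphere 0 1 \<inter> {y. a \<bullet> y = b} \<and>
        S = sphere z r \<inter> {y. a \<bullet> y = b})"

end

theory Submission
  imports Defs
begin

text \<open>
  Write \<open>A\<^sub>H = \<mu> Id\<close>; then \<open>\<mu> = |H|\<^sup>2\<close>. The tangential part of the biharmonic equation gives
  \<open>trace A\<^bsub>\<nabla>H\<^esub> = - grad \<mu>\<close>, whereas the traced Codazzi equation gives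
  \<open>trace A\<^bsub>\<nabla>H\<^esub> = (1 - m/2) grad \<mu>\<close>; so \<open>(m - 4) grad \<mu> = 0\<close> and \<open>\<mu>\<close> is a constant \<open>c\<close>. The normal
  part gives \<open>|\<nabla>\<^sup>\<bottom> H|\<^sup>2 = m c (1 - c)\<close>, and \<open>c \<noteq> 0\<close> since the immersion is not harmonic. In
  codimension 2 the Codazzi equation forces \<open>\<nabla>\<^sup>\<bottom> H = 0\<close>, hence \<open>c = 1\<close> and \<open>dH = - d\<phi>\<close>, so that
  \<open>a = \<phi> + H\<close> is a constant vector with \<open>a \<bullet> a = 2\<close> and \<open>a \<bullet> \<phi> = 1\<close>. Conversely, in the
  hypersphere \<open>a \<bullet> y = 1\<close> minimality means \<open>H = a - \<phi>\<close>, which solves the biharmonic equation.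
\<close>

section \<open>Calculus of smooth maps\<close>

text \<open>Since trace B = m H and dH . H = grad \<mu> / 2, the traced Codazzi equation picks up
  the term m/2. Differentiating the constant |H|^2 twice and inserting the biharmonic equation gives
  |dH|^2 = m c, of which the tangential part - c dx of dH accounts for m c^2; what remains is the
  normal part. If that were nonzero, Codazzi would kill the part of the second fundamental form
  orthogonal to H, and the commuting of third derivatives excludes such an umbilical immersion for m
  >= 2. All computations take place in the ambient Euclidean space: covariant derivatives are
  partial derivatives minus explicit components, and the structure equations arise by
  differentiating inner products known on a whole chart. The obstacle is globalization: H is defined
  chart by chart and a chart image may be disconnected, so \<phi> + H makes sense on the manifold
  only once H is known to be independent of the chart, and constants come from connectedness. The
  radius reflects |\<phi>|^2 + |H|^2 = 2: the hyperplane a . y = 1 has distance 1/sqrt 2 from the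
  origin.\<close>

lemma frechet_derivative_cong_open:
  assumes "open S" "x \<in> S" "\<And>y. y \<in> S \<Longrightarrow> f y = g y"
  shows "frechet_derivative f (at x) = frechet_derivative g (at x)"
proof -
  \<comment> \<open>\<open>frechet_derivative\<close> is a choice among all derivatives, so it
    suffices that both functions have the same ones.\<close>
  have "(f has_derivative D) (at x) \<longleftrightarrow> (g has_derivative D) (at x)" for D
    using assms has_derivative_transform_within_open[OF _ assms(1,2)] by metis
  then show ?thesis by (simp add: frechet_derivative_def)
qed

lemma differentiable_cong_open:
  assumes "open S" "x \<in> S" "\<And>y. y \<in> S \<Longrightarrow> f y = g y"
  shows "f differentiable (at x) \<longleftrightarrow> g differentiable (at x)"
  using assms has_derivative_transform_within_open[OF _ assms(1,2)]
  unfolding differentiable_def by metis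

lemma Ck_on_cong:
  assumes "open S" "\<And>x. x \<in> S \<Longrightarrow> f x = g x"
  shows "Ck_on k f S \<longleftrightarrow> Ck_on k g S"
  using assms(2)
proof (induction k arbitrary: f g)
  case 0
  then show ?case by (simp cong: continuous_on_cong)
next
  case (Suc k)
  have "Ck_on k (\<lambda>x. frechet_derivative f (at x) v) S = Ck_on k (\<lambda>x. frechet_derivative g (at x) v) S" for v
    by (rule Suc.IH) (use frechet_derivative_cong_open[OF assms(1)] Suc.prems in metis)
  moreover have "(\<forall>x\<in>S. f differentiable (at x)) \<longleftrightarrow> (\<forall>x\<in>S. g differentiable (at x))"
    using differentiable_cong_open[OF assms(1), of _ f g] Suc.prems by blast
  ultimately show ?case by simp
qed

text \<open>\<open>Ck_on (Suc k) f\<close> speaks of the directional derivatives of \<open>f\<close>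
  and not of \<open>Ck_on k f\<close>, so an induction is needed; its base is that differentiability
  implies continuity.\<close>

lemma Ck_on_SucD: "Ck_on (Suc k) f S \<Longrightarrow> Ck_on k f S"
proof (induction k arbitrary: f)
  case 0
  then show ?case
    by (simp add: differentiable_imp_continuous_on differentiable_on_def differentiable_at_withinI)
next
  case (Suc k)
  then show ?case by (metis Ck_on.simps(2))
qed

lemma Ck_on_const [simp]: "Ck_on k (\<lambda>x. c) S"
  by (induction k arbitrary: c) auto

lemma Ck_on_add:
  assumes "open S" "Ck_on k f S" "Ck_on k g S"
  shows "Ck_on k (\<lambda>x. f x + g x) S"
  using assms(2,3)
proof (induction k arbitrary: f g)
  case 0
  then show ?case by (simp add: continuous_on_add)
next
  case (Suc k)
  have "Ck_on k (\<lambda>x. frechet_derivative (\<lambda>x. f x + g x) (at x) v) S" for v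
  proof (subst Ck_on_cong[OF assms(1)])
    show "Ck_on k (\<lambda>x. frechet_derivative f (at x) v + frechet_derivative g (at x) v) S"
      by (rule Suc.IH) (use Suc.prems in auto)
    fix x assume "x \<in> S"
    then have "((\<lambda>x. f x + g x) has_derivative
        (\<lambda>v. frechet_derivative f (at x) v + frechet_derivative g (at x) v)) (at x)"
      using Suc.prems by (intro has_derivative_add) (auto simp: frechet_derivative_works[symmetric])
    from frechet_derivative_at[OF this]
    show "frechet_derivative (\<lambda>x. f x + g x) (at x) v =
      frechet_derivative f (at x) v + frechet_derivative g (at x) v"
      by metis
  qed
  then show ?case using Suc.prems by auto
qed

text \<open>One Leibniz rule for an abstract bilinear product serves multiplication, scaling and
  inner product at once.\<close>

lemma (in bounded_bilinear) frechet_derivative_bilinear: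
  assumes "f differentiable (at x)" "g differentiable (at x)"
  shows "frechet_derivative (\<lambda>x. prod (f x) (g x)) (at x) v =
     prod (f x) (frechet_derivative g (at x) v) + prod (frechet_derivative f (at x) v) (g x)"
    and "(\<lambda>x. prod (f x) (g x)) differentiable (at x)"
proof -
  have "((\<lambda>x. prod (f x) (g x)) has_derivative
     (\<lambda>v. prod (f x) (frechet_derivative g (at x) v) + prod (frechet_derivative f (at x) v) (g x))) (at x)"
    using assms by (intro FDERIV) (auto simp: frechet_derivative_works[symmetric])
  from frechet_derivative_at[OF this] differentiableI[OF this]
  show "frechet_derivative (\<lambda>x. prod (f x) (g x)) (at x) v =
     prod (f x) (frechet_derivative g (at x) v) + prod (frechet_derivative f (at x) v) (g x)"
   "(\<lambda>x. prod (f x) (g x)) differentiable (at x)"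
    by metis+
qed

lemma (in bounded_bilinear) Ck_on_bilinear:
  assumes "open S" "Ck_on k f S" "Ck_on k g S"
  shows "Ck_on k (\<lambda>x. prod (f x) (g x)) S"
  using assms(2,3)
proof (induction k arbitrary: f g)
  case 0
  then show ?case by (simp add: continuous_on)
next
  case (Suc k)
  have "Ck_on k (\<lambda>x. frechet_derivative (\<lambda>x. prod (f x) (g x)) (at x) v) S" for v
  proof (subst Ck_on_cong[OF assms(1)])
    show "Ck_on k (\<lambda>x. prod (f x) (frechet_derivative g (at x) v) + prod (frechet_derivative f (at x) v) (g x)) S"
      by (intro Ck_on_add assms(1) Suc.IH) (use Suc.prems in \<open>auto intro: Ck_on_SucD\<close>)
  qed (use Suc.prems in \<open>auto simp: frechet_derivative_bilinear\<close>)
  then show ?case using Suc.prems by (auto intro: frechet_derivative_bilinear(2))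
qed

text \<open>The derivative of 1/f is a product of f' with two factors 1/f, so the product rule
  reduces order k + 1 of 1/f to order k of 1/f.\<close>

lemma Ck_on_inverse:
  fixes f :: "'a::euclidean_space \<Rightarrow> real"
  assumes "open S" "\<And>x. x \<in> S \<Longrightarrow> f x \<noteq> 0" "Ck_on k f S"
  shows "Ck_on k (\<lambda>x. inverse (f x)) S"
  using assms(3)
proof (induction k)
  case 0
  then show ?case using assms(2) by (simp add: continuous_on_inverse)
next
  case (Suc k)
  have der: "((\<lambda>x. inverse (f x)) has_derivative
      (\<lambda>v. - (inverse (f x) * frechet_derivative f (at x) v * inverse (f x)))) (at x)" if "x \<in> S" for x
    using Suc.prems that assms(2)[OF that]
    by (intro Deriv.has_derivative_inverse) (auto simp: frechet_derivative_works[symmetric])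
  have "Ck_on k (\<lambda>x. frechet_derivative (\<lambda>x. inverse (f x)) (at x) v) S" for v
  proof (subst Ck_on_cong[OF assms(1)])
    show "Ck_on k (\<lambda>x. (-1) * ((inverse (f x) * frechet_derivative f (at x) v) * inverse (f x))) S"
      by (intro bounded_bilinear.Ck_on_bilinear[OF bounded_bilinear_mult] assms(1) Suc.IH Ck_on_const)
        (use Suc.prems Ck_on_SucD in auto)
    show "frechet_derivative (\<lambda>x. inverse (f x)) (at x) v =
        (-1) * ((inverse (f x) * frechet_derivative f (at x) v) * inverse (f x))" if "x \<in> S" for x
      using frechet_derivative_at[OF der[OF that]] by (metis mult_minus1)
  qed
  moreover have "\<forall>x\<in>S. (\<lambda>x. inverse (f x)) differentiable (at x)"
    using der by (auto intro: differentiableI)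
  ultimately show ?case by simp
qed

lemma smooth_on_const [simp]: "smooth_on (\<lambda>x. c) S"
  by (simp add: smooth_on_def)

lemma smooth_on_add:
  "open S \<Longrightarrow> smooth_on f S \<Longrightarrow> smooth_on g S \<Longrightarrow> smooth_on (\<lambda>x. f x + g x) S"
  by (simp add: smooth_on_def Ck_on_add)

lemma (in bounded_bilinear) smooth_on_bilinear:
  "open S \<Longrightarrow> smooth_on f S \<Longrightarrow> smooth_on g S \<Longrightarrow> smooth_on (\<lambda>x. prod (f x) (g x)) S"
  by (simp add: smooth_on_def Ck_on_bilinear)

lemmas smooth_on_mult = bounded_bilinear.smooth_on_bilinear[OF bounded_bilinear_mult]
  and smooth_on_scaleR = bounded_bilinear.smooth_on_bilinear[OF bounded_bilinear_scaleR]
  and smooth_on_inner = bounded_bilinear.smooth_on_bilinear[OF bounded_bilinear_inner]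

lemma smooth_on_diff:
  assumes "open S" "smooth_on f S" "smooth_on g S"
  shows "smooth_on (\<lambda>x. f x - g x) S"
  using smooth_on_add[OF assms(1,2) smooth_on_scaleR[OF assms(1) smooth_on_const[of "-1"] assms(3)]]
  by simp

lemma smooth_on_inverse:
  fixes f :: "'a::euclidean_space \<Rightarrow> real"
  shows "open S \<Longrightarrow> (\<And>x. x \<in> S \<Longrightarrow> f x \<noteq> 0) \<Longrightarrow> smooth_on f S \<Longrightarrow> smooth_on (\<lambda>x. inverse (f x)) S"
  by (simp add: smooth_on_def Ck_on_inverse)

lemma smooth_on_sum:
  "open S \<Longrightarrow> (\<And>i. i \<in> I \<Longrightarrow> smooth_on (f i) S) \<Longrightarrow> smooth_on (\<lambda>x. \<Sum>i\<in>I. f i x) S"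
  by (induction I rule: infinite_finite_induct) (auto intro!: smooth_on_add)

lemma smooth_on_prod:
  fixes f :: "'i \<Rightarrow> 'a::euclidean_space \<Rightarrow> real"
  shows "open S \<Longrightarrow> (\<And>i. i \<in> I \<Longrightarrow> smooth_on (f i) S) \<Longrightarrow> smooth_on (\<lambda>x. \<Prod>i\<in>I. f i x) S"
  by (induction I rule: infinite_finite_induct) (auto intro!: smooth_on_mult)

lemma smooth_on_cong:
  "open S \<Longrightarrow> (\<And>x. x \<in> S \<Longrightarrow> f x = g x) \<Longrightarrow> smooth_on f S \<longleftrightarrow> smooth_on g S"
  unfolding smooth_on_def using Ck_on_cong by metis

lemma smooth_on_pd: "smooth_on f S \<Longrightarrow> smooth_on (pd i f) S"
  unfolding smooth_on_def pd_def[abs_def] by (metis Ck_on.simps(2))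

lemma smooth_on_imp_differentiable: "smooth_on f S \<Longrightarrow> x \<in> S \<Longrightarrow> f differentiable (at x)"
  unfolding smooth_on_def by (metis Ck_on.simps(2))

section \<open>Smoothness of determinants and inverse matrices\<close>

lemma smooth_on_det:
  fixes A :: "'a::euclidean_space \<Rightarrow> real ^ 'm::finite ^ 'm"
  assumes "open S" "\<And>i j. smooth_on (\<lambda>p. A p $ i $ j) S"
  shows "smooth_on (\<lambda>p. det (A p)) S"
  unfolding det_def by (intro smooth_on_sum smooth_on_mult smooth_on_prod smooth_on_const assms)

lemma matrix_inv_inverse:
  fixes A :: "real ^ 'm::finite ^ 'm"
  assumes "invertible A"
  shows "A ** matrix_inv A = mat 1" "matrix_inv A ** A = mat 1"
proof -
  have "\<exists>A'. A ** A' = mat 1 \<and> A' ** A = mat 1"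
    using assms by (simp add: invertible_def)
  from someI_ex[OF this] show "A ** matrix_inv A = mat 1" "matrix_inv A ** A = mat 1"
    by (simp_all add: matrix_inv_def)
qed

text \<open>\<open>matrix_inv\<close> is given by a choice operator; Cramer's rule makes its entries
  quotients of polynomials in the entries of \<open>A\<close>, from which smoothness can be read
  off.\<close>

lemma matrix_inv_cramer:
  fixes A :: "real ^ 'm::finite ^ 'm"
  assumes "det A \<noteq> 0"
  shows "matrix_inv A $ k $ l = det (\<chi> i j. if j = k then axis l 1 $ i else A $ i $ j) * inverse (det A)"
proof -
  have "invertible A" using assms by (simp add: invertible_det_nz)
  then have "A ** matrix_inv A = mat 1" by (rule matrix_inv_inverse)
  then have "A *v (matrix_inv A *v axis l 1) = axis l 1"
    by (simp add: matrix_vector_mul_assoc)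
  then have "matrix_inv A *v axis l 1 = (\<chi> k. det (\<chi> i j. if j = k then axis l 1 $ i else A $ i $ j) / det A)"
    using cramer[OF assms] by blast
  moreover have "(matrix_inv A *v axis l 1) $ k = matrix_inv A $ k $ l"
    by (simp add: matrix_vector_mul_component cart_eq_inner_axis[symmetric])
  ultimately show ?thesis by (simp add: divide_inverse)
qed

lemma smooth_on_matrix_inv:
  fixes A :: "'a::euclidean_space \<Rightarrow> real ^ 'm::finite ^ 'm"
  assumes "open S" "\<And>i j. smooth_on (\<lambda>p. A p $ i $ j) S" "\<And>p. p \<in> S \<Longrightarrow> det (A p) \<noteq> 0"
  shows "smooth_on (\<lambda>p. matrix_inv (A p) $ k $ l) S"
proof (subst smooth_on_cong[OF assms(1)])
  have "smooth_on (\<lambda>p. (\<chi> i j. if j = k then axis l 1 $ i else A p $ i $ j) $ i $ j) S" for i j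
    using assms(2)[of i j] by (cases "j = k") auto
  then show "smooth_on (\<lambda>p. det (\<chi> i j. if j = k then axis l 1 $ i else A p $ i $ j)
      * inverse (det (A p))) S"
    by (intro smooth_on_mult smooth_on_inverse smooth_on_det assms)
qed (use matrix_inv_cramer assms(3) in blast)

section \<open>Symmetry of second derivatives\<close>

lemma second_difference_mvt:
  fixes f :: "'a::euclidean_space \<Rightarrow> real"
  assumes t: "0 < t" and S: "\<And>a b. \<lbrakk>0 \<le> a; a \<le> t; 0 \<le> b; b \<le> t\<rbrakk> \<Longrightarrow> p + a *\<^sub>R u + b *\<^sub>R v \<in> S"
    and f: "\<And>x. x \<in> S \<Longrightarrow> f differentiable (at x)"
    and fu: "\<And>x. x \<in> S \<Longrightarrow> (\<lambda>x. frechet_derivative f (at x) u) differentiable (at x)"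
  shows "\<exists>a b. 0 \<le> a \<and> a \<le> t \<and> 0 \<le> b \<and> b \<le> t \<and>
    f (p + t *\<^sub>R u + t *\<^sub>R v) - f (p + t *\<^sub>R u) - f (p + t *\<^sub>R v) + f p =
    t * t * frechet_derivative (\<lambda>x. frechet_derivative f (at x) u) (at (p + a *\<^sub>R u + b *\<^sub>R v)) v"
proof -
  have Df: "((\<lambda>s. f (p + s *\<^sub>R u + b *\<^sub>R v)) has_real_derivative
      frechet_derivative f (at (p + s *\<^sub>R u + b *\<^sub>R v)) u) (at s)"
    if "0 \<le> s" "s \<le> t" "0 \<le> b" "b \<le> t" for s b
  proof -
    have "(f has_derivative frechet_derivative f (at (p + s *\<^sub>R u + b *\<^sub>R v))) (at (p + s *\<^sub>R u + b *\<^sub>R v))"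
      using f[OF S[OF that]] by (simp add: frechet_derivative_works[symmetric])
    moreover have "((\<lambda>s. p + s *\<^sub>R u + b *\<^sub>R v) has_derivative (\<lambda>h. h *\<^sub>R u)) (at s)"
      by (auto intro!: derivative_eq_intros)
    ultimately have *: "((\<lambda>s. f (p + s *\<^sub>R u + b *\<^sub>R v)) has_derivative
        (\<lambda>h. frechet_derivative f (at (p + s *\<^sub>R u + b *\<^sub>R v)) (h *\<^sub>R u))) (at s)"
      using has_derivative_compose by blast
    have "linear (frechet_derivative f (at (p + s *\<^sub>R u + b *\<^sub>R v)))"
      using f[OF S[OF that]] by (rule linear_frechet_derivative)
    then show ?thesis
      using * unfolding has_field_derivative_def
      by (simp add: linear_cmul mult_commute_abs)
  qed
  define F where "F x = frechet_derivative f (at x) u" for x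
  have DF: "((\<lambda>b. F (p + s *\<^sub>R u + b *\<^sub>R v)) has_real_derivative
      frechet_derivative F (at (p + s *\<^sub>R u + b *\<^sub>R v)) v) (at b)"
    if "0 \<le> s" "s \<le> t" "0 \<le> b" "b \<le> t" for s b
  proof -
    have d: "F differentiable at (p + s *\<^sub>R u + b *\<^sub>R v)"
      using fu[OF S[OF that]] by (simp add: F_def[abs_def])
    then have "(F has_derivative frechet_derivative F (at (p + s *\<^sub>R u + b *\<^sub>R v))) (at (p + s *\<^sub>R u + b *\<^sub>R v))"
      by (simp add: frechet_derivative_works[symmetric])
    moreover have "((\<lambda>b. p + s *\<^sub>R u + b *\<^sub>R v) has_derivative (\<lambda>h. h *\<^sub>R v)) (at b)"
      by (auto intro!: derivative_eq_intros)
    ultimately have *: "((\<lambda>b. F (p + s *\<^sub>R u + b *\<^sub>R v)) has_derivative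
        (\<lambda>h. frechet_derivative F (at (p + s *\<^sub>R u + b *\<^sub>R v)) (h *\<^sub>R v))) (at b)"
      using has_derivative_compose by blast
    show ?thesis
      using * linear_frechet_derivative[OF d] unfolding has_field_derivative_def
      by (simp add: linear_cmul mult_commute_abs)
  qed
  \<comment> \<open>Mean value theorem along \<open>u\<close>, applied to the increment of
    \<open>f\<close> over \<open>t *\<^sub>R v\<close>; the second application goes along
    \<open>v\<close>.\<close>
  have "\<exists>z>0. z < t \<and> (f (p + t *\<^sub>R u + t *\<^sub>R v) - f (p + t *\<^sub>R u + 0 *\<^sub>R v)) -
      (f (p + 0 *\<^sub>R u + t *\<^sub>R v) - f (p + 0 *\<^sub>R u + 0 *\<^sub>R v)) =
      (t - 0) * (F (p + z *\<^sub>R u + t *\<^sub>R v) - F (p + z *\<^sub>R u + 0 *\<^sub>R v))"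
    by (rule MVT2[OF t]) (unfold F_def, intro DERIV_diff Df, use t in auto)
  then obtain a where a: "0 < a" "a < t" and
    eq1: "(f (p + t *\<^sub>R u + t *\<^sub>R v) - f (p + t *\<^sub>R u + 0 *\<^sub>R v)) -
      (f (p + 0 *\<^sub>R u + t *\<^sub>R v) - f (p + 0 *\<^sub>R u + 0 *\<^sub>R v)) =
      (t - 0) * (F (p + a *\<^sub>R u + t *\<^sub>R v) - F (p + a *\<^sub>R u + 0 *\<^sub>R v))" by blast
  have "\<exists>z>0. z < t \<and> F (p + a *\<^sub>R u + t *\<^sub>R v) - F (p + a *\<^sub>R u + 0 *\<^sub>R v) =
      (t - 0) * frechet_derivative F (at (p + a *\<^sub>R u + z *\<^sub>R v)) v"
    by (rule MVT2[OF t]) (intro DF, use a in auto)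
  then obtain b where "0 < b" "b < t" and
    eq2: "F (p + a *\<^sub>R u + t *\<^sub>R v) - F (p + a *\<^sub>R u + 0 *\<^sub>R v) =
      (t - 0) * frechet_derivative F (at (p + a *\<^sub>R u + b *\<^sub>R v)) v" by blast
  with a eq1 show ?thesis
    by (intro exI[of _ a] exI[of _ b]) (simp add: F_def[abs_def])
qed

text \<open>The second difference over a parallelogram is symmetric in \<open>u\<close> and
  \<open>v\<close>. It is \<open>t * t\<close> times either mixed derivative at some nearby point,
  and continuity moves both points to \<open>p\<close>.\<close>

lemma second_derivative_symmetric_real:
  fixes f :: "'a::euclidean_space \<Rightarrow> real"
  assumes "open S" "p \<in> S" "Ck_on 2 f S"
  shows "frechet_derivative (\<lambda>x. frechet_derivative f (at x) u) (at p) v =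
         frechet_derivative (\<lambda>x. frechet_derivative f (at x) v) (at p) u"
proof -
  define G where "G u v x = frechet_derivative (\<lambda>x. frechet_derivative f (at x) u) (at x) v" for u v x
  have C: "continuous_on S (G u v)" and f: "\<And>x. x \<in> S \<Longrightarrow> f differentiable (at x)"
    and fu: "\<And>x. x \<in> S \<Longrightarrow> (\<lambda>x. frechet_derivative f (at x) u) differentiable (at x)" for u v
    using assms(3) unfolding G_def[abs_def] by (auto simp: numeral_2_eq_2)
  have "\<bar>G u v p - G v u p\<bar> < e" if e: "e > 0" for e
  proof -
    have "isCont (G u v) p" "isCont (G v u) p"
      using C assms(1,2) by (auto simp: continuous_on_eq_continuous_at)
    then obtain d1 d2 where d: "d1 > 0" "d2 > 0"
      and d1: "\<And>x. dist x p < d1 \<Longrightarrow> dist (G u v x) (G u v p) < e/2"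
      and d2: "\<And>x. dist x p < d2 \<Longrightarrow> dist (G v u x) (G v u p) < e/2"
      using e unfolding continuous_at_eps_delta by (metis half_gt_zero)
    obtain d3 where d3: "d3 > 0" "ball p d3 \<subseteq> S" using assms(1,2) openE by blast
    define dd where "dd = min d1 (min d2 d3)"
    \<comment> \<open>Keeps the whole parallelogram within distance \<open>dd\<close> of
      \<open>p\<close>; the \<open>+ 1\<close> covers \<open>u = v = 0\<close>.\<close>
    define t where "t = dd / (norm u + norm v + 1)"
    have dd: "dd > 0" using d d3 by (simp add: dd_def)
    have np: "norm u + norm v + 1 > 0" by (smt (verit) norm_ge_zero)
    have t: "t > 0" using dd np by (simp add: t_def)
    have near: "dist (p + a *\<^sub>R u + b *\<^sub>R v) p < dd" "dist (p + a *\<^sub>R v + b *\<^sub>R u) p < dd"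
      if ab: "0 \<le> a" "a \<le> t" "0 \<le> b" "b \<le> t" for a b
    proof -
      have *: "norm (a *\<^sub>R u + b *\<^sub>R v) < dd" if ab: "0 \<le> a" "a \<le> t" "0 \<le> b" "b \<le> t" for a b
      proof -
        have "norm (a *\<^sub>R u + b *\<^sub>R v) \<le> a * norm u + b * norm v"
          using ab by (metis abs_of_nonneg norm_scaleR norm_triangle_ineq)
        also have "\<dots> \<le> t * norm u + t * norm v"
          using ab by (intro add_mono mult_right_mono) auto
        also have "\<dots> < t * (norm u + norm v + 1)" using t by (simp add: algebra_simps)
        also have "\<dots> = dd" using np by (simp add: t_def)
        finally show ?thesis .
      qed
      show "dist (p + a *\<^sub>R u + b *\<^sub>R v) p < dd" "dist (p + a *\<^sub>R v + b *\<^sub>R u) p < dd"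
        using *[of a b] *[of b a] ab by (auto simp: dist_norm add.assoc add.commute[of "a *\<^sub>R v"])
    qed
    have S1: "p + a *\<^sub>R u + b *\<^sub>R v \<in> S" "p + a *\<^sub>R v + b *\<^sub>R u \<in> S"
      if ab: "0 \<le> a" "a \<le> t" "0 \<le> b" "b \<le> t" for a b
      using near[OF ab] d3(2) by (auto simp: dd_def subset_eq dist_commute)
    obtain a b where ab: "0 \<le> a" "a \<le> t" "0 \<le> b" "b \<le> t" and
      e1: "f (p + t *\<^sub>R u + t *\<^sub>R v) - f (p + t *\<^sub>R u) - f (p + t *\<^sub>R v) + f p =
      t * t * G u v (p + a *\<^sub>R u + b *\<^sub>R v)"
      using second_difference_mvt[OF t S1(1) f fu[of _ u]] unfolding G_def by blast
    obtain a' b' where ab': "0 \<le> a'" "a' \<le> t" "0 \<le> b'" "b' \<le> t" and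
      e2: "f (p + t *\<^sub>R v + t *\<^sub>R u) - f (p + t *\<^sub>R v) - f (p + t *\<^sub>R u) + f p =
      t * t * G v u (p + a' *\<^sub>R v + b' *\<^sub>R u)"
      using second_difference_mvt[OF t S1(2) f fu[of _ v]] unfolding G_def by blast
    have "t * t * G u v (p + a *\<^sub>R u + b *\<^sub>R v) = t * t * G v u (p + a' *\<^sub>R v + b' *\<^sub>R u)"
      using e1 e2 by (simp add: algebra_simps)
    then have "G u v (p + a *\<^sub>R u + b *\<^sub>R v) = G v u (p + a' *\<^sub>R v + b' *\<^sub>R u)"
      using t by simp
    moreover have "dist (G u v (p + a *\<^sub>R u + b *\<^sub>R v)) (G u v p) < e/2"
      using near(1)[OF ab] by (intro d1) (simp add: dd_def)
    moreover have "dist (G v u (p + a' *\<^sub>R v + b' *\<^sub>R u)) (G v u p) < e/2"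
      using near(2)[OF ab'] by (intro d2) (simp add: dd_def)
    ultimately show ?thesis unfolding dist_real_def by linarith
  qed
  \<comment> \<open>A positive gap, taken as \<open>e\<close>, would be smaller than itself.\<close>
  from this[of "\<bar>G u v p - G v u p\<bar>"] have "G u v p = G v u p" by force
  then show ?thesis by (simp add: G_def)
qed

section \<open>Partial derivatives\<close>

lemma pd_eqI: "(f has_derivative D) (at p) \<Longrightarrow> pd i f p = D (axis i 1)"
  unfolding pd_def using frechet_derivative_at by metis

lemma pd_cong_open:
  "open S \<Longrightarrow> p \<in> S \<Longrightarrow> (\<And>y. y \<in> S \<Longrightarrow> f y = g y) \<Longrightarrow> pd i f p = pd i g p"
  unfolding pd_def using frechet_derivative_cong_open by metis

lemma pd_const [simp]: "pd i (\<lambda>x. c) p = 0"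
  by (simp add: pd_def)

lemma pd_add:
  assumes "f differentiable (at p)" "g differentiable (at p)"
  shows "pd i (\<lambda>x. f x + g x) p = pd i f p + pd i g p"
  using pd_eqI[OF has_derivative_add[of f "frechet_derivative f (at p)" _ g "frechet_derivative g (at p)"]] assms
  by (simp add: pd_def frechet_derivative_works[symmetric])

lemma pd_diff:
  assumes "f differentiable (at p)" "g differentiable (at p)"
  shows "pd i (\<lambda>x. f x - g x) p = pd i f p - pd i g p"
  using pd_eqI[OF has_derivative_diff[of f "frechet_derivative f (at p)" _ g "frechet_derivative g (at p)"]] assms
  by (simp add: pd_def frechet_derivative_works[symmetric])

lemma (in bounded_bilinear) pd_bilinear:
  assumes "f differentiable (at p)" "g differentiable (at p)"
  shows "pd i (\<lambda>x. prod (f x) (g x)) p = prod (f p) (pd i g p) + prod (pd i f p) (g p)"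
  unfolding pd_def by (rule frechet_derivative_bilinear) fact+

lemmas pd_mult = bounded_bilinear.pd_bilinear[OF bounded_bilinear_mult]
  and pd_scaleR = bounded_bilinear.pd_bilinear[OF bounded_bilinear_scaleR]
  and pd_inner = bounded_bilinear.pd_bilinear[OF bounded_bilinear_inner]

lemma pd_cmult: "f differentiable (at p) \<Longrightarrow> pd i (\<lambda>x. c *\<^sub>R f x) p = c *\<^sub>R pd i f p"
  by (simp add: pd_scaleR)

lemma frechet_derivative_eq_sum_pd:
  fixes f :: "real ^ 'm::finite \<Rightarrow> 'b::real_normed_vector"
  assumes "f differentiable (at p)"
  shows "frechet_derivative f (at p) v = (\<Sum>k\<in>UNIV. (v $ k) *\<^sub>R pd k f p)"
proof -
  have "v = (\<Sum>k\<in>UNIV. (v $ k) *\<^sub>R axis k 1)"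
    using basis_expansion[of v] by (simp add: scalar_mult_eq_scaleR)
  then have "frechet_derivative f (at p) v = frechet_derivative f (at p) (\<Sum>k\<in>UNIV. (v $ k) *\<^sub>R axis k 1)"
    by simp
  also have "\<dots> = (\<Sum>k\<in>UNIV. (v $ k) *\<^sub>R pd k f p)"
    using linear_frechet_derivative[OF assms] by (simp add: linear_sum linear_cmul pd_def)
  finally show ?thesis .
qed

text \<open>The mean value argument is confined to real-valued functions, hence the reduction to
  components.\<close>

lemma pd_commute:
  fixes f :: "real ^ 'm::finite \<Rightarrow> 'b::euclidean_space"
  assumes "open S" "p \<in> S" "smooth_on f S"
  shows "pd i (pd j f) p = pd j (pd i f) p"
proof (rule euclidean_eqI)
  fix b :: 'b assume "b \<in> Basis"
  have *: "pd i (pd j f) p \<bullet> b = pd i (pd j (\<lambda>x. f x \<bullet> b)) p" for i j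
  proof -
    have "pd i (pd j (\<lambda>x. f x \<bullet> b)) p = pd i (\<lambda>x. pd j f x \<bullet> b) p"
      by (rule pd_cong_open[OF assms(1,2)])
        (simp add: pd_inner smooth_on_imp_differentiable[OF assms(3)])
    also have "\<dots> = pd i (pd j f) p \<bullet> b"
      by (simp add: pd_inner smooth_on_imp_differentiable[OF smooth_on_pd[OF assms(3)] assms(2)])
    finally show ?thesis by simp
  qed
  have "Ck_on 2 (\<lambda>x. f x \<bullet> b) S"
    using smooth_on_inner[OF assms(1,3) smooth_on_const] by (simp add: smooth_on_def)
  from second_derivative_symmetric_real[OF assms(1,2) this]
  show "pd i (pd j f) p \<bullet> b = pd j (pd i f) p \<bullet> b"
    unfolding * by (simp add: pd_def[abs_def])
qed

section \<open>The round sphere\<close>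

lemma orth_proj_eqI:
  assumes "subspace V" "w \<in> V" "\<And>u. u \<in> V \<Longrightarrow> (v - w) \<bullet> u = 0"
  shows "orth_proj V v = w"
  unfolding orth_proj_def
proof (rule the_equality)
  show "w \<in> V \<and> (\<forall>u\<in>V. (v - w) \<bullet> u = 0)" using assms by auto
  fix w' assume w': "w' \<in> V \<and> (\<forall>u\<in>V. (v - w') \<bullet> u = 0)"
  then have "w' - w \<in> V" using assms by (simp add: subspace_diff)
  then have "(v - w) \<bullet> (w' - w) = 0" "(v - w') \<bullet> (w' - w) = 0" using assms w' by auto
  then have "(w' - w) \<bullet> (w' - w) = 0" by (simp add: inner_diff_left)
  then show "w' = w" by simp
qed

text \<open>Differentiating both constraints along a curve gives the two orthogonality conditions;
  conversely a straight line is pushed back radially from \<open>z\<close>. With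
  \<open>a = 0\<close> the hyperplane condition is empty, so full spheres are covered too.\<close>

lemma tangent_space_round_sphere:
  fixes a z :: "'e::euclidean_space"
  assumes r: "0 < r" and q: "norm (q - z) = r" "a \<bullet> q = a \<bullet> z"
  shows "tangent_space (sphere z r \<inter> {y. a \<bullet> y = a \<bullet> z}) q = {v. v \<bullet> (q - z) = 0 \<and> v \<bullet> a = 0}"
    (is "tangent_space ?S q = ?T")
proof (intro set_eqI iffI)
  fix v assume "v \<in> tangent_space ?S q"
  then obtain \<gamma> e where e: "e > 0" and \<gamma>: "\<And>t. \<bar>t\<bar> < e \<Longrightarrow> \<gamma> t \<in> ?S" "\<gamma> 0 = q"
    and d: "(\<gamma> has_vector_derivative v) (at 0)"
    unfolding tangent_space_def by auto
  have d': "(\<gamma> has_derivative (\<lambda>h. h *\<^sub>R v)) (at 0)"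
    using d by (simp add: has_vector_derivative_def)
  have ball: "0 \<in> ball (0::real) e" "open (ball (0::real) e)" using e by auto
  have eq: "(\<lambda>h. 2 * ((q - z) \<bullet> (h *\<^sub>R v))) = (\<lambda>h. 0)"
  proof (rule has_derivative_unique)
    show "((\<lambda>t. (\<gamma> t - z) \<bullet> (\<gamma> t - z)) has_derivative (\<lambda>h. 2 * ((q - z) \<bullet> (h *\<^sub>R v)))) (at 0)"
      by (rule derivative_eq_intros d' refl)+ (simp add: \<gamma> inner_commute fun_eq_iff)
    show "((\<lambda>t. (\<gamma> t - z) \<bullet> (\<gamma> t - z)) has_derivative (\<lambda>h. 0)) (at 0)"
    proof (rule has_derivative_transform_within_open[OF _ ball(2,1)])
      show "((\<lambda>t. r\<^sup>2) has_derivative (\<lambda>h. 0)) (at (0::real))" by simp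
      show "r\<^sup>2 = (\<gamma> t - z) \<bullet> (\<gamma> t - z)" if "t \<in> ball 0 e" for t
        using \<gamma>(1)[of t] that by (simp add: dot_square_norm dist_norm norm_minus_commute)
    qed
  qed
  have eq2: "(\<lambda>h. a \<bullet> (h *\<^sub>R v)) = (\<lambda>h. 0)"
  proof (rule has_derivative_unique)
    show "((\<lambda>t. a \<bullet> \<gamma> t) has_derivative (\<lambda>h. a \<bullet> (h *\<^sub>R v))) (at 0)"
      by (intro has_derivative_inner_right d')
    show "((\<lambda>t. a \<bullet> \<gamma> t) has_derivative (\<lambda>h. 0)) (at 0)"
    proof (rule has_derivative_transform_within_open[OF _ ball(2,1)])
      show "((\<lambda>t. a \<bullet> z) has_derivative (\<lambda>h. 0)) (at (0::real))" by simp
      show "a \<bullet> z = a \<bullet> \<gamma> t" if "t \<in> ball 0 e" for t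
        using \<gamma>(1)[of t] that by simp
    qed
  qed
  show "v \<in> ?T"
    using fun_cong[OF eq, of 1] fun_cong[OF eq2, of 1] by (simp add: inner_commute)
next
  fix v assume v: "v \<in> ?T"
  define c where "c = (norm v)\<^sup>2 / r\<^sup>2"
  have c: "c \<ge> 0" by (simp add: c_def)
  \<comment> \<open>As \<open>v\<close> is orthogonal to \<open>q - z\<close>, the line q - z + t v
    has norm r sqrt (1 + t^2 c). The factor \<open>f\<close> rescales this to \<open>r\<close>, and
    its derivative vanishes at 0, so the velocity stays \<open>v\<close>.\<close>
  define f where "f t = 1 / sqrt (1 + t\<^sup>2 * c)" for t
  define \<gamma> where "\<gamma> t = z + f t *\<^sub>R (q - z + t *\<^sub>R v)" for t
  have pos: "1 + t\<^sup>2 * c > 0" for t using c by (smt (verit) mult_nonneg_nonneg zero_le_power2)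
  have "(f has_real_derivative 0) (at 0)"
    unfolding f_def[abs_def] by (auto intro!: derivative_eq_intros)
  then have df: "(f has_derivative (\<lambda>h. 0)) (at 0)"
    by (simp add: has_field_derivative_def lambda_zero)
  have "(\<gamma> has_derivative (\<lambda>h. h *\<^sub>R v)) (at 0)"
    unfolding \<gamma>_def[abs_def] by (rule derivative_eq_intros df refl)+ (simp add: f_def)
  then have "(\<gamma> has_vector_derivative v) (at 0)" by (simp add: has_vector_derivative_def)
  moreover have "\<gamma> 0 = q" by (simp add: \<gamma>_def f_def)
  moreover have "\<gamma> t \<in> ?S" for t
  proof -
    have "(q - z + t *\<^sub>R v) \<bullet> (q - z + t *\<^sub>R v) = (q - z) \<bullet> (q - z) + t\<^sup>2 * (v \<bullet> v)"
      using v by (simp add: inner_add_left inner_add_right inner_commute power2_eq_square)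
    also have "\<dots> = r\<^sup>2 * (1 + t\<^sup>2 * c)"
      using r q by (simp add: c_def dot_square_norm algebra_simps)
    finally have "norm (q - z + t *\<^sub>R v) = r * sqrt (1 + t\<^sup>2 * c)"
      using r by (simp add: norm_eq_sqrt_inner real_sqrt_mult)
    then have "norm (\<gamma> t - z) = r"
      using pos[of t] r by (simp add: \<gamma>_def f_def)
    moreover have "a \<bullet> \<gamma> t = a \<bullet> z"
      using v q by (simp add: \<gamma>_def inner_add_right inner_diff_right inner_commute)
    ultimately show ?thesis by (simp add: dist_norm norm_minus_commute)
  qed
  ultimately show "v \<in> tangent_space ?S q"
    unfolding tangent_space_def by (auto intro!: exI[of _ \<gamma>] exI[of _ "1::real"])
qed

lemma tangent_space_unit_sphere:
  fixes q :: "'e::euclidean_space"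
  assumes "norm q = 1"
  shows "tangent_space (sphere 0 1) q = {v. v \<bullet> q = 0}"
  using tangent_space_round_sphere[of 1 q 0 0] assms by simp

lemma subspace_orthogonal_vectors: "subspace {v. v \<bullet> q = 0}"
  by (auto simp: subspace_def inner_add_left)

lemma orth_proj_unit_sphere:
  fixes q :: "'e::euclidean_space"
  assumes "norm q = 1"
  shows "orth_proj (tangent_space (sphere 0 1) q) v = v - (v \<bullet> q) *\<^sub>R q"
proof -
  have "q \<bullet> q = 1" using assms by (simp add: dot_square_norm)
  then show ?thesis unfolding tangent_space_unit_sphere[OF assms]
    by (intro orth_proj_eqI subspace_orthogonal_vectors) (auto simp: inner_diff_left inner_diff_right inner_commute)
qed

text \<open>A derivative within \<open>N\<close> is ambiguous off the tangent directions;
  composition with a curve in \<open>N\<close> of velocity \<open>v\<close> reduces it to a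
  derivative in one variable, which is unique.\<close>

lemma deriv_along_eqI:
  assumes D: "(Y has_derivative D) (at q within N)" and v: "v \<in> tangent_space N q"
  shows "deriv_along N Y q v = D v"
proof -
  obtain \<gamma> e where e: "e > 0" and \<gamma>: "\<And>t. \<bar>t\<bar> < e \<Longrightarrow> \<gamma> t \<in> N" "\<gamma> 0 = q"
    and d: "(\<gamma> has_vector_derivative v) (at 0)"
    using v unfolding tangent_space_def by auto
  have *: "((\<lambda>t. Y (\<gamma> t)) has_derivative (\<lambda>h. D' (h *\<^sub>R v))) (at 0)"
    if D': "(Y has_derivative D') (at q within N)" for D'
  proof -
    have "(\<gamma> has_derivative (\<lambda>h. h *\<^sub>R v)) (at 0 within ball 0 e)"
      using d by (simp add: has_vector_derivative_def has_derivative_at_withinI)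
    moreover have "(Y has_derivative D') (at (\<gamma> 0) within \<gamma> ` ball 0 e)"
      unfolding \<gamma>(2) by (rule has_derivative_subset[OF D']) (use \<gamma>(1) in auto)
    ultimately have "(Y \<circ> \<gamma> has_derivative D' \<circ> (\<lambda>h. h *\<^sub>R v)) (at 0 within ball 0 e)"
      by (rule diff_chain_within)
    then show ?thesis using e at_within_open[of 0 "ball (0::real) e"] by (simp add: o_def)
  qed
  have "D' v = D v" if "(Y has_derivative D') (at q within N)" for D'
    using fun_cong[OF has_derivative_unique[OF *[OF that] *[OF D]], of 1] by simp
  with D show ?thesis unfolding deriv_along_def by (intro the_equality) metis+
qed

text \<open>A field on the sphere is known only there; \<open>Y'\<close> is any extension
  differentiable in the ambient space.\<close>

lemma deriv_along_unit_sphere: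
  fixes q :: "'e::euclidean_space"
  assumes "norm q = 1" "v \<bullet> q = 0"
    and "\<forall>y. norm y = 1 \<longrightarrow> Y y = Y' y" "(Y' has_derivative D) (at q)"
  shows "deriv_along (sphere 0 1) Y q v = D v"
proof (rule deriv_along_eqI)
  show "(Y has_derivative D) (at q within sphere 0 1)"
    by (rule has_derivative_transform[OF _ _ has_derivative_at_withinI[OF assms(4)]])
      (use assms in auto)
qed (use assms tangent_space_unit_sphere in auto)

lemma nabla_unit_sphere:
  fixes q :: "'e::euclidean_space"
  assumes "norm q = 1" "X q \<bullet> q = 0"
    and "\<forall>y. norm y = 1 \<longrightarrow> Y y = Y' y" "(Y' has_derivative D) (at q)"
  shows "nabla (sphere 0 1) X Y q = D (X q) - (D (X q) \<bullet> q) *\<^sub>R q"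
proof -
  have "deriv_along (sphere 0 1) Y q (X q) = D (X q)"
    using assms by (rule deriv_along_unit_sphere)
  then show ?thesis by (simp add: nabla_def orth_proj_unit_sphere assms(1))
qed

lemma riemann_unit_sphere:
  fixes q :: "'e::euclidean_space"
  assumes q: "norm q = 1" and t: "u \<bullet> q = 0" "v \<bullet> q = 0" "w \<bullet> q = 0"
  shows "riemann (sphere 0 1) q u v w = (v \<bullet> w) *\<^sub>R u - (u \<bullet> w) *\<^sub>R v"
proof -
  let ?N = "sphere (0::'e) 1"
  define P where "P u q = u - (u \<bullet> q) *\<^sub>R q" for u q :: 'e
  \<comment> \<open>The covariant derivative of \<open>P w\<close> along \<open>P v\<close>,
    extended from the sphere to the whole space by a polynomial formula so that it can be
    differentiated once more.\<close>
  define K where "K v w q = - (w \<bullet> q) *\<^sub>R P v q" for v w q :: 'e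
  have qq: "y \<bullet> y = 1" if "norm y = 1" for y :: 'e using that by (simp add: dot_square_norm)
  have ext: "\<forall>y. norm y = 1 \<longrightarrow> tangent_ext ?N u y = P u y" for u
     by (simp add: tangent_ext_def orth_proj_unit_sphere P_def)
  have Pt: "P u y \<bullet> y = 0" if "norm y = 1" for u y
    using qq[OF that] by (simp add: P_def inner_diff_left)
  have dP: "(P w has_derivative (\<lambda>h. - ((w \<bullet> h) *\<^sub>R y) - (w \<bullet> y) *\<^sub>R h)) (at y)" for w y
    unfolding P_def[abs_def] by (rule derivative_eq_intros refl)+ (simp add: fun_eq_iff)
  have nab: "\<forall>y. norm y = 1 \<longrightarrow> nabla ?N (tangent_ext ?N v) (tangent_ext ?N w) y = K v w y" for v w
  proof (intro allI impI)
    fix y :: 'e assume y: "norm y = 1"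
    have "nabla ?N (tangent_ext ?N v) (tangent_ext ?N w) y =
      (- ((w \<bullet> P v y) *\<^sub>R y) - (w \<bullet> y) *\<^sub>R P v y) - ((- ((w \<bullet> P v y) *\<^sub>R y) - (w \<bullet> y) *\<^sub>R P v y) \<bullet> y) *\<^sub>R y"
      using nabla_unit_sphere[OF y _ ext dP, of "tangent_ext ?N v"] Pt[OF y] ext y by simp
    also have "\<dots> = K v w y"
      using Pt[OF y] qq[OF y] by (simp add: K_def inner_diff_left)
    finally show "nabla ?N (tangent_ext ?N v) (tangent_ext ?N w) y = K v w y" .
  qed
  have nab2: "nabla ?N (tangent_ext ?N u) (nabla ?N (tangent_ext ?N v) (tangent_ext ?N w)) q = - (w \<bullet> u) *\<^sub>R v"
    if t: "u \<bullet> q = 0" "v \<bullet> q = 0" "w \<bullet> q = 0" for u v w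
  proof -
    \<comment> \<open>At \<open>q\<close> the factor \<open>w \<bullet> q\<close> vanishes, so the
      derivative of \<open>P v\<close> does not enter.\<close>
    have dK: "(K v w has_derivative (\<lambda>h. - ((w \<bullet> h) *\<^sub>R v))) (at q)"
      unfolding K_def[abs_def] by (rule derivative_eq_intros dP refl)+ (use t in \<open>simp add: P_def\<close>)
    have "P u q = u" using t by (simp add: P_def)
    then have eu: "tangent_ext ?N u q = u" using ext q by simp
    show ?thesis
      using nabla_unit_sphere[OF q _ nab dK, of "tangent_ext ?N u"] t by (simp add: eu)
  qed
  have da: "deriv_along ?N (tangent_ext ?N v) q u = - ((v \<bullet> u) *\<^sub>R q)"
    if t: "u \<bullet> q = 0" "v \<bullet> q = 0" for u v
    using deriv_along_unit_sphere[OF q t(1) ext dP] t by simp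
  have eu: "tangent_ext ?N u q = u" if "u \<bullet> q = 0" for u using that ext q by (simp add: P_def)
  \<comment> \<open>By \<open>da\<close> both terms of the bracket are the same multiple of
    \<open>q\<close>.\<close>
  have br: "lie_bracket ?N (tangent_ext ?N u) (tangent_ext ?N v) q = 0"
    unfolding lie_bracket_def using t da eu by (simp add: inner_commute)
  have "nabla ?N (lie_bracket ?N (tangent_ext ?N u) (tangent_ext ?N v)) (tangent_ext ?N w) q = 0"
    using nabla_unit_sphere[OF q _ ext dP, of "lie_bracket ?N (tangent_ext ?N u) (tangent_ext ?N v)"]
    by (simp add: br)
  then show ?thesis
    unfolding riemann_def curvature_op_def using nab2 t by (simp add: inner_commute)
qed

section \<open>Immersions into the unit sphere\<close>

lemma metric_trace_inner_left:
  "metric_trace g p T \<bullet> v = metric_trace g p (\<lambda>i j. T i j \<bullet> v)"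
  by (simp add: metric_trace_def inner_sum_left)

lemma metric_trace_add:
  "metric_trace g p (\<lambda>i j. S i j + T i j) = metric_trace g p S + metric_trace g p T"
  by (simp add: metric_trace_def sum.distrib scaleR_add_right)

lemma metric_trace_diff:
  "metric_trace g p (\<lambda>i j. S i j - T i j) = metric_trace g p S - metric_trace g p T"
  by (simp add: metric_trace_def sum_subtractf scaleR_diff_right)

lemma metric_trace_minus:
  "metric_trace g p (\<lambda>i j. - T i j) = - metric_trace g p T"
  by (simp add: metric_trace_def sum_negf)

lemma metric_trace_scaleR:
  "metric_trace g p (\<lambda>i j. c *\<^sub>R T i j) = c *\<^sub>R metric_trace g p T"
  by (simp add: metric_trace_def scaleR_sum_right mult.commute)

lemma metric_trace_mult:
  fixes T :: "'m::finite \<Rightarrow> 'm \<Rightarrow> real"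
  shows "metric_trace g p (\<lambda>i j. c * T i j) = c * metric_trace g p T"
  using metric_trace_scaleR[of g p c T] by simp

lemma metric_trace_scaleR_left:
  "metric_trace g p (\<lambda>i j. T i j *\<^sub>R v) = metric_trace g p T *\<^sub>R v"
  by (simp add: metric_trace_def scaleR_sum_left)

section \<open>Structure equations of an immersion in a single chart\<close>

locale spherical_immersion =
  fixes x :: "real ^ 'm::finite \<Rightarrow> 'e::euclidean_space" and U :: "(real ^ 'm) set"
  assumes open_U: "open U"
    and smooth_x: "smooth_on x U"
    and inj_dx: "p \<in> U \<Longrightarrow> inj (frechet_derivative x (at p))"
    and norm_x: "p \<in> U \<Longrightarrow> norm (x p) = 1"
begin

abbreviation g where "g p i j \<equiv> pd i x p \<bullet> pd j x p"
abbreviation tr :: "real ^ 'm \<Rightarrow> ('m \<Rightarrow> 'm \<Rightarrow> 'b::real_vector) \<Rightarrow> 'b"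
  where "tr \<equiv> metric_trace (induced_metric x)"
abbreviation Gam where "Gam \<equiv> christoffel (induced_metric x)"
abbreviation H where "H \<equiv> mean_curvature (sphere 0 1) x"

text \<open>The second fundamental form in the sphere: the Christoffel sum is the tangential part of
  the Hessian of \<open>x\<close>, and the last summand removes its component
  \<open>- g p i j\<close> along \<open>x p\<close>.\<close>

definition B where
  "B p i j = pd i (pd j x) p - (\<Sum>k\<in>UNIV. Gam p k i j *\<^sub>R pd k x p) + g p i j *\<^sub>R x p"

lemma smooth_dx: "smooth_on (pd i x) U"
  by (rule smooth_on_pd[OF smooth_x])

lemma smooth_ddx: "smooth_on (pd i (pd j x)) U"
  by (rule smooth_on_pd[OF smooth_dx])

lemma smooth_metric: "smooth_on (\<lambda>p. induced_metric x p $ i $ j) U"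
  by (simp add: induced_metric_def smooth_on_inner open_U smooth_dx)

lemma dx_eq: "p \<in> U \<Longrightarrow> frechet_derivative x (at p) v = (\<Sum>k\<in>UNIV. (v $ k) *\<^sub>R pd k x p)"
  by (rule frechet_derivative_eq_sum_pd) (rule smooth_on_imp_differentiable[OF smooth_x])

text \<open>The quadratic form of the induced metric is |dx v|^2, so injectivity of the differential
  makes the kernel trivial.\<close>

lemma invertible_metric:
  assumes "p \<in> U"
  shows "invertible (induced_metric x p)"
proof -
  have lin: "linear (frechet_derivative x (at p))"
    using smooth_on_imp_differentiable[OF smooth_x assms] by (rule linear_frechet_derivative)
  have "v = 0" if v: "induced_metric x p *v v = 0" for v
  proof -
    have "frechet_derivative x (at p) v \<bullet> frechet_derivative x (at p) v = v \<bullet> (induced_metric x p *v v)"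
      by (simp add: dx_eq[OF assms] inner_sum_left inner_sum_right induced_metric_def
          matrix_vector_mult_def inner_vec_def sum_distrib_left ac_simps inner_commute)
    then have "frechet_derivative x (at p) v = 0" using v by simp
    then show "v = 0"
      using inj_dx[OF assms] lin by (metis injD linear_0)
  qed
  then show ?thesis
    using matrix_left_invertible_ker[of "induced_metric x p"] invertible_left_inverse by blast
qed

lemma det_metric: "p \<in> U \<Longrightarrow> det (induced_metric x p) \<noteq> 0"
  using invertible_metric by (simp add: invertible_det_nz)

lemma smooth_inverse_metric: "smooth_on (\<lambda>p. matrix_inv (induced_metric x p) $ i $ j) U"
  by (rule smooth_on_matrix_inv[OF open_U smooth_metric det_metric])

lemma metric_inverse:
  assumes "p \<in> U"
  shows "(\<Sum>j\<in>UNIV. matrix_inv (induced_metric x p) $ i $ j * g p j k) = (if i = k then 1 else 0)"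
    and "(\<Sum>j\<in>UNIV. g p i j * matrix_inv (induced_metric x p) $ j $ k) = (if i = k then 1 else 0)"
proof -
  note * = matrix_inv_inverse[OF invertible_metric[OF assms]]
  have "(matrix_inv (induced_metric x p) ** induced_metric x p) $ i $ k = mat 1 $ i $ k"
    by (simp add: *)
  then show "(\<Sum>j\<in>UNIV. matrix_inv (induced_metric x p) $ i $ j * g p j k) = (if i = k then 1 else 0)"
    by (simp add: matrix_matrix_mult_def mat_def induced_metric_def)
  have "(induced_metric x p ** matrix_inv (induced_metric x p)) $ i $ k = mat 1 $ i $ k"
    by (simp add: *)
  then show "(\<Sum>j\<in>UNIV. g p i j * matrix_inv (induced_metric x p) $ j $ k) = (if i = k then 1 else 0)"
    by (simp add: matrix_matrix_mult_def mat_def induced_metric_def)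
qed

lemma inverse_metric_sym:
  assumes "p \<in> U"
  shows "matrix_inv (induced_metric x p) $ i $ j = matrix_inv (induced_metric x p) $ j $ i"
proof -
  let ?A = "induced_metric x p"
  note * = matrix_inv_inverse[OF invertible_metric[OF assms]]
  have "transpose ?A = ?A"
    by (simp add: transpose_def induced_metric_def inner_commute vec_eq_iff)
  then have "transpose (matrix_inv ?A) ** ?A = mat 1"
    using * by (metis matrix_transpose_mul transpose_mat)
  then have "transpose (matrix_inv ?A) = transpose (matrix_inv ?A) ** (?A ** matrix_inv ?A)"
    by (simp add: *)
  also have "\<dots> = matrix_inv ?A"
    using \<open>transpose (matrix_inv ?A) ** ?A = mat 1\<close> by (simp add: matrix_mul_assoc)
  finally have "transpose (matrix_inv ?A) $ j $ i = matrix_inv ?A $ j $ i" by simp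
  then show ?thesis by (simp add: transpose_def)
qed

lemma tr_metric:
  assumes "p \<in> U"
  shows "tr p (\<lambda>i j. g p i j) = real CARD('m)"
proof -
  have "tr p (\<lambda>i j. g p i j) = (\<Sum>i\<in>UNIV. \<Sum>j\<in>UNIV. matrix_inv (induced_metric x p) $ i $ j * g p j i)"
    unfolding metric_trace_def real_scaleR_def by (intro sum.cong refl) (simp add: inner_commute)
  then show ?thesis by (simp add: metric_inverse[OF assms])
qed

lemma tr_contract:
  fixes a :: "'m \<Rightarrow> real"
  assumes "p \<in> U"
  shows "tr p (\<lambda>i j. a j * g p i l) = a l" and "tr p (\<lambda>i j. a i * g p j l) = a l"
proof -
  have "tr p (\<lambda>i j. a j * g p i l) =
      (\<Sum>j\<in>UNIV. a j * (\<Sum>i\<in>UNIV. matrix_inv (induced_metric x p) $ j $ i * g p i l))"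
    unfolding metric_trace_def
    by (subst sum.swap) (simp add: sum_distrib_left ac_simps inverse_metric_sym[OF assms, of _ ])
  then show "tr p (\<lambda>i j. a j * g p i l) = a l"
    using assms by (simp add: metric_inverse if_distrib cong: if_cong)
  have "tr p (\<lambda>i j. a i * g p j l) =
      (\<Sum>i\<in>UNIV. a i * (\<Sum>j\<in>UNIV. matrix_inv (induced_metric x p) $ i $ j * g p j l))"
    unfolding metric_trace_def
    by (simp add: sum_distrib_left ac_simps)
  then show "tr p (\<lambda>i j. a i * g p j l) = a l"
    using assms by (simp add: metric_inverse if_distrib cong: if_cong)
qed

lemma x_x: "p \<in> U \<Longrightarrow> x p \<bullet> x p = 1"
  using norm_x by (simp add: dot_square_norm)

text \<open>Source of the relations below: an inner product that is constant on \<open>U\<close> is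
  differentiated, which moves the derivative from one factor to the other.\<close>

lemma pd_inner_const:
  assumes "smooth_on f U" "smooth_on h U" "p \<in> U" "\<And>q. q \<in> U \<Longrightarrow> f q \<bullet> h q = c"
  shows "pd i f p \<bullet> h p = - (f p \<bullet> pd i h p)"
proof -
  have "pd i (\<lambda>q. f q \<bullet> h q) p = pd i (\<lambda>q. c) p"
    by (rule pd_cong_open[OF open_U assms(3)]) (rule assms(4))
  then show ?thesis
    using assms by (simp add: pd_inner smooth_on_imp_differentiable)
qed

lemma dx_x: "p \<in> U \<Longrightarrow> pd i x p \<bullet> x p = 0"
  using pd_inner_const[OF smooth_x smooth_x _ x_x, of p i] by (simp add: inner_commute)

lemma ddx_x: "p \<in> U \<Longrightarrow> pd i (pd j x) p \<bullet> x p = - g p i j"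
  using pd_inner_const[OF smooth_dx smooth_x _ dx_x, of p i j] by (simp add: inner_commute)

lemma ddx_sym: "p \<in> U \<Longrightarrow> pd i (pd j x) p = pd j (pd i x) p"
  by (rule pd_commute[OF open_U _ smooth_x])

lemma pd_metric:
  "p \<in> U \<Longrightarrow> pd l (\<lambda>q. g q i j) p = pd l (pd i x) p \<bullet> pd j x p + pd i x p \<bullet> pd l (pd j x) p"
  by (simp add: pd_inner smooth_on_imp_differentiable[OF smooth_dx] add.commute)

text \<open>By symmetry of second derivatives the three metric derivatives in
  \<open>christoffel\<close> add up to twice the tangential component of the Hessian; the inverse
  metric then cancels against the metric.\<close>

lemma christoffel_metric:
  assumes "p \<in> U"
  shows "(\<Sum>k\<in>UNIV. Gam p k i j * g p k l) = pd i (pd j x) p \<bullet> pd l x p"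
proof -
  have s: "(\<Sum>k\<in>UNIV. matrix_inv (induced_metric x p) $ k $ l' * g p k l) = (if l = l' then 1 else 0)" for l'
    using metric_inverse(2)[OF assms, of l l'] by (simp add: inner_commute mult.commute)
  have "Gam p k i j = (\<Sum>l\<in>UNIV. matrix_inv (induced_metric x p) $ k $ l * (pd i (pd j x) p \<bullet> pd l x p))" for k
  proof -
    have "pd i (\<lambda>q. g q j l) p + pd j (\<lambda>q. g q i l) p - pd l (\<lambda>q. g q i j) p
        = 2 * (pd i (pd j x) p \<bullet> pd l x p)" for l
      using assms by (simp add: pd_metric ddx_sym[OF assms, of l] ddx_sym[OF assms, of j i] inner_commute)
    then show ?thesis
      by (simp add: christoffel_def induced_metric_def sum_distrib_left)
  qed
  then have "(\<Sum>k\<in>UNIV. Gam p k i j * g p k l) =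
    (\<Sum>k\<in>UNIV. \<Sum>l'\<in>UNIV. (pd i (pd j x) p \<bullet> pd l' x p) * (matrix_inv (induced_metric x p) $ k $ l' * g p k l))"
    by (simp add: sum_distrib_left sum_distrib_right ac_simps)
  also have "\<dots> = (\<Sum>l'\<in>UNIV. (pd i (pd j x) p \<bullet> pd l' x p) *
      (\<Sum>k\<in>UNIV. matrix_inv (induced_metric x p) $ k $ l' * g p k l))"
    by (subst sum.swap) (simp add: sum_distrib_left)
  also have "\<dots> = pd i (pd j x) p \<bullet> pd l x p"
    by (simp add: s if_distrib cong: if_cong)
  finally show ?thesis .
qed

lemma christoffel_sym: "p \<in> U \<Longrightarrow> Gam p k i j = Gam p k j i"
  unfolding christoffel_def by (simp add: induced_metric_def inner_commute add.commute)

lemma B_sym: "p \<in> U \<Longrightarrow> B p i j = B p j i"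
  by (simp add: B_def ddx_sym[of p i j] christoffel_sym[of p _ i j] inner_commute)

lemma B_x: "p \<in> U \<Longrightarrow> B p i j \<bullet> x p = 0"
  by (simp add: B_def inner_diff_left inner_add_left inner_sum_left ddx_x dx_x x_x)

lemma B_dx: "p \<in> U \<Longrightarrow> B p i j \<bullet> pd l x p = 0"
  by (simp add: B_def inner_diff_left inner_add_left inner_sum_left
      christoffel_metric dx_x inner_commute[of "x p"])

lemma B_inner:
  assumes "p \<in> U" "v \<bullet> x p = 0" "\<And>l. v \<bullet> pd l x p = 0"
  shows "B p i j \<bullet> v = pd i (pd j x) p \<bullet> v"
  using assms by (simp add: B_def inner_diff_right inner_add_right inner_sum_right inner_commute[of _ v])

lemma tangent_image_eq: "p \<in> U \<Longrightarrow> tangent_image x p = range (\<lambda>v. \<Sum>k\<in>UNIV. (v $ k) *\<^sub>R pd k x p)"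
  by (simp add: tangent_image_def dx_eq)

lemma subspace_tangent_image: "p \<in> U \<Longrightarrow> subspace (tangent_image x p)"
  unfolding tangent_image_def
  by (rule linear_subspace_image) (auto intro: linear_frechet_derivative smooth_on_imp_differentiable[OF smooth_x])

lemma orth_proj_tangent_image:
  assumes "p \<in> U" "w = (\<Sum>k\<in>UNIV. c k *\<^sub>R pd k x p)" "\<And>l. (v - w) \<bullet> pd l x p = 0"
  shows "orth_proj (tangent_image x p) v = w"
proof (rule orth_proj_eqI[OF subspace_tangent_image[OF assms(1)]])
  show "w \<in> tangent_image x p"
    unfolding tangent_image_eq[OF assms(1)] assms(2) by (rule range_eqI[of _ _ "\<chi> k. c k"]) simp
qed (use assms(3) in \<open>auto simp: tangent_image_eq[OF assms(1)] inner_sum_right\<close>)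

lemma orth_proj_tangent_image_dot:
  assumes "p \<in> U"
  shows "orth_proj (tangent_image x p) v \<bullet> pd l x p = v \<bullet> pd l x p"
    and "\<exists>c. orth_proj (tangent_image x p) v = (\<Sum>k\<in>UNIV. c k *\<^sub>R pd k x p)"
proof -
  \<comment> \<open>Solves the normal equations of the projection: inner products with the frame,
    with the index raised by the inverse metric.\<close>
  define c where "c k = (\<Sum>j\<in>UNIV. matrix_inv (induced_metric x p) $ k $ j * (v \<bullet> pd j x p))" for k
  define w where "w = (\<Sum>k\<in>UNIV. c k *\<^sub>R pd k x p)"
  have w: "w \<bullet> pd l x p = v \<bullet> pd l x p" for l
  proof -
    have "w \<bullet> pd l x p = (\<Sum>k\<in>UNIV. \<Sum>j\<in>UNIV. (v \<bullet> pd j x p) * (g p l k * matrix_inv (induced_metric x p) $ k $ j))"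
      by (simp add: w_def c_def inner_sum_left sum_distrib_left sum_distrib_right ac_simps inner_commute[of "pd _ x p" "pd l x p"])
    also have "\<dots> = (\<Sum>j\<in>UNIV. (v \<bullet> pd j x p) * (\<Sum>k\<in>UNIV. g p l k * matrix_inv (induced_metric x p) $ k $ j))"
      by (subst sum.swap) (simp add: sum_distrib_left)
    also have "\<dots> = v \<bullet> pd l x p"
      by (simp add: metric_inverse[OF assms] if_distrib cong: if_cong)
    finally show ?thesis .
  qed
  have "orth_proj (tangent_image x p) v = w"
    by (rule orth_proj_tangent_image[OF assms w_def]) (simp add: inner_diff_left w)
  then show "orth_proj (tangent_image x p) v \<bullet> pd l x p = v \<bullet> pd l x p"
    "\<exists>c. orth_proj (tangent_image x p) v = (\<Sum>k\<in>UNIV. c k *\<^sub>R pd k x p)"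
    using w w_def by auto
qed

lemma pullback_nabla_sphere:
  assumes "p \<in> U"
  shows "pullback_nabla (sphere 0 1) x i V p = pd i V p - (pd i V p \<bullet> x p) *\<^sub>R x p"
  unfolding pullback_nabla_def by (rule orth_proj_unit_sphere[OF norm_x[OF assms]])

lemma nabla_d_eq: "p \<in> U \<Longrightarrow> nabla_d (sphere 0 1) (induced_metric x) x p i j = B p i j"
  by (simp add: nabla_d_def pullback_nabla_sphere B_def ddx_x)

text \<open>Together with \<open>nabla_d_eq\<close> this puts the same tensor \<open>B\<close>
  behind the tension field and the mean curvature, whence \<open>tension_eq\<close>.\<close>

lemma second_ff_eq:
  assumes "p \<in> U"
  shows "second_ff (sphere 0 1) x p i j = B p i j"
proof -
  have "orth_proj (tangent_image x p) (pd i (pd j x) p + g p i j *\<^sub>R x p) = (\<Sum>k\<in>UNIV. Gam p k i j *\<^sub>R pd k x p)"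
    using B_dx[OF assms] by (intro orth_proj_tangent_image[OF assms refl]) (simp add: B_def algebra_simps)
  then show ?thesis
    by (simp add: second_ff_def pullback_nabla_sphere[OF assms] ddx_x[OF assms] B_def)
qed

lemma H_eq: "p \<in> U \<Longrightarrow> H p = (1 / real CARD('m)) *\<^sub>R tr p (B p)"
  by (simp add: mean_curvature_def metric_trace_def second_ff_eq)

lemma tension_eq: "p \<in> U \<Longrightarrow> tension (sphere 0 1) (induced_metric x) x p = real CARD('m) *\<^sub>R H p"
  by (simp add: H_eq tension_def metric_trace_def nabla_d_eq)

lemma tr_B: "p \<in> U \<Longrightarrow> tr p (B p) = real CARD('m) *\<^sub>R H p"
  by (simp add: H_eq)

lemma H_x: "p \<in> U \<Longrightarrow> H p \<bullet> x p = 0"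
  by (simp add: H_eq metric_trace_inner_left B_x) (simp add: metric_trace_def)

lemma H_dx: "p \<in> U \<Longrightarrow> H p \<bullet> pd l x p = 0"
  by (simp add: H_eq metric_trace_inner_left B_dx) (simp add: metric_trace_def)

text \<open>\<open>H\<close> is defined through projections; \<open>H_eq\<close> replaces it on
  \<open>U\<close> by an expression in derivatives of \<open>x\<close> and the inverse metric, whose
  smoothness is visible.\<close>

lemma smooth_H: "smooth_on H U"
proof -
  have G: "smooth_on (\<lambda>p. Gam p k i j) U" for k i j
    unfolding christoffel_def
    by (intro smooth_on_mult smooth_on_sum smooth_on_diff smooth_on_add smooth_on_const open_U
        smooth_inverse_metric smooth_on_pd smooth_metric)
  have "smooth_on (\<lambda>p. B p i j) U" for i j
    unfolding B_def
    by (intro smooth_on_scaleR smooth_on_sum smooth_on_diff smooth_on_add open_U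
        smooth_ddx G smooth_dx smooth_x smooth_on_inner)
  then have "smooth_on (\<lambda>p. (1 / real CARD('m)) *\<^sub>R tr p (B p)) U"
    unfolding metric_trace_def
    by (intro smooth_on_scaleR smooth_on_sum smooth_on_const open_U smooth_inverse_metric)
  then show ?thesis
    using smooth_on_cong[OF open_U H_eq] by simp
qed

lemma smooth_dH: "smooth_on (pd i H) U"
  by (rule smooth_on_pd[OF smooth_H])

lemma dH_x: "p \<in> U \<Longrightarrow> pd i H p \<bullet> x p = 0"
  using pd_inner_const[OF smooth_H smooth_x _ H_x, of p i] by (simp add: H_dx)

lemma dH_dx: "p \<in> U \<Longrightarrow> pd i H p \<bullet> pd j x p = - (H p \<bullet> pd i (pd j x) p)"
  using pd_inner_const[OF smooth_H smooth_dx _ H_dx, of p i] by simp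

lemma ddH_x: "p \<in> U \<Longrightarrow> pd i (pd j H) p \<bullet> x p = - (pd j H p \<bullet> pd i x p)"
  using pd_inner_const[OF smooth_dH smooth_x _ dH_x, of p i] by simp

text \<open>The Laplace-Beltrami operator of the induced metric on the components of \<open>H\<close>.\<close>

definition LH where
  "LH p = tr p (\<lambda>i j. pd i (pd j H) p - (\<Sum>k\<in>UNIV. Gam p k i j *\<^sub>R pd k H p))"

text \<open>The \<open>x p\<close> term is the correction for projecting second derivatives of
  \<open>H\<close> back to the sphere; the last term comes from curvature 1, for which the curvature
  trace of the tension field is - m times that field.\<close>

lemma bitension_eq:
  assumes p: "p \<in> U"
  shows "bitension (sphere 0 1) (induced_metric x) x p = real CARD('m) *\<^sub>R
    (LH p + tr p (\<lambda>i j. pd j H p \<bullet> pd i x p) *\<^sub>R x p + real CARD('m) *\<^sub>R H p)"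
proof -
  let ?m = "real CARD('m)"
  let ?N = "sphere (0::'e) 1"
  let ?t = "tension ?N (induced_metric x) x"
  have n1: "pullback_nabla ?N x j ?t q = ?m *\<^sub>R pd j H q" if q: "q \<in> U" for j q
  proof -
    have "pd j ?t q = pd j (\<lambda>q. ?m *\<^sub>R H q) q"
      by (rule pd_cong_open[OF open_U q]) (rule tension_eq)
    then show ?thesis
      using dH_x[OF q]
      by (simp add: pullback_nabla_sphere[OF q] pd_cmult smooth_on_imp_differentiable[OF smooth_H q])
  qed
  have "pullback_nabla ?N x i (pullback_nabla ?N x j ?t) p
      = ?m *\<^sub>R (pd i (pd j H) p + (pd j H p \<bullet> pd i x p) *\<^sub>R x p)" for i j
  proof -
    have "pd i (pullback_nabla ?N x j ?t) p = pd i (\<lambda>q. ?m *\<^sub>R pd j H q) p"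
      by (rule pd_cong_open[OF open_U p]) (rule n1)
    then show ?thesis
      using ddH_x[OF p]
      by (simp add: pullback_nabla_sphere[OF p] pd_cmult smooth_on_imp_differentiable[OF smooth_dH p]
          scaleR_add_right)
  qed
  then have "nabla2 ?N (induced_metric x) x ?t p i j = ?m *\<^sub>R
      ((pd i (pd j H) p - (\<Sum>k\<in>UNIV. Gam p k i j *\<^sub>R pd k H p)) + (pd j H p \<bullet> pd i x p) *\<^sub>R x p)" for i j
    by (simp add: nabla2_def n1[OF p] algebra_simps scaleR_sum_right scaleR_left_commute)
  then have "nabla2 ?N (induced_metric x) x ?t p = (\<lambda>i j. ?m *\<^sub>R
      ((pd i (pd j H) p - (\<Sum>k\<in>UNIV. Gam p k i j *\<^sub>R pd k H p)) + (pd j H p \<bullet> pd i x p) *\<^sub>R x p))"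
    by (intro ext)
  then have 1: "tr p (nabla2 ?N (induced_metric x) x ?t p) =
      ?m *\<^sub>R (LH p + tr p (\<lambda>i j. pd j H p \<bullet> pd i x p) *\<^sub>R x p)"
    by (simp add: metric_trace_scaleR metric_trace_add metric_trace_scaleR_left LH_def)
  have "riemann ?N (x p) (pd i x p) (?t p) (pd j x p) = g p i j *\<^sub>R - (?m *\<^sub>R H p)" for i j
    by (subst riemann_unit_sphere[OF norm_x[OF p]])
      (simp_all add: tension_eq[OF p] H_x[OF p] H_dx[OF p] dx_x[OF p])
  then have 2: "tr p (\<lambda>i j. riemann ?N (x p) (pd i x p) (?t p) (pd j x p)) = - (?m *\<^sub>R ?m *\<^sub>R H p)"
    using tr_metric[OF p] by (simp only: metric_trace_scaleR_left) simp
  show ?thesis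
    unfolding bitension_def rough_laplacian_def 1 2 by (simp add: scaleR_add_right)
qed

end

section \<open>The hypersphere of radius 1/sqrt 2 and its tangent spaces\<close>

lemma small_hypersphere_eq:
  fixes a :: "'f::euclidean_space"
  assumes a: "a \<bullet> a = 2"
  shows "sphere 0 1 \<inter> {y. a \<bullet> y = 1} = sphere ((1/2) *\<^sub>R a) (1 / sqrt 2) \<inter> {y. a \<bullet> y = 1}"
proof -
  let ?z = "(1/2) *\<^sub>R a" and ?r = "1 / sqrt 2"
  have "norm (y - ?z) = ?r \<longleftrightarrow> norm y = 1" if "a \<bullet> y = 1" for y
  proof -
    \<comment> \<open>The centre \<open>?z\<close> is the foot of the perpendicular from the origin
      to the hyperplane, and its squared norm is 1/2.\<close>
    have "(norm (y - ?z))\<^sup>2 = y \<bullet> y - 1 / 2"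
      using that a by (simp add: power2_norm_eq_inner inner_diff_left inner_diff_right inner_commute)
    moreover have "norm (y - ?z) = ?r \<longleftrightarrow> (norm (y - ?z))\<^sup>2 = ?r\<^sup>2"
      by (rule power2_eq_iff_nonneg[symmetric]) auto
    moreover have "norm y = 1 \<longleftrightarrow> y \<bullet> y = 1" by (simp add: norm_eq_1)
    ultimately show ?thesis by (auto simp: power_divide)
  qed
  then show ?thesis by (auto simp: dist_norm norm_minus_commute)
qed

lemma tangent_space_hyperplane:
  fixes a :: "'e::euclidean_space"
  assumes a: "a \<bullet> a = 2" and q: "norm q = 1" "a \<bullet> q = 1"
  shows "tangent_space (sphere 0 1 \<inter> {y. a \<bullet> y = 1}) q = {v. v \<bullet> q = 0 \<and> v \<bullet> a = 0}"
proof -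
  let ?z = "(1/2) *\<^sub>R a" and ?r = "1 / sqrt 2"
  have S: "sphere 0 1 \<inter> {y. a \<bullet> y = 1} = sphere ?z ?r \<inter> {y. a \<bullet> y = a \<bullet> ?z}"
    using small_hypersphere_eq[OF a] a by simp
  have q': "q \<in> sphere ?z ?r"
    using small_hypersphere_eq[OF a] q by (auto simp: set_eq_iff)
  have "tangent_space (sphere 0 1 \<inter> {y. a \<bullet> y = 1}) q = {v. v \<bullet> (q - ?z) = 0 \<and> v \<bullet> a = 0}"
    unfolding S
  proof (rule tangent_space_round_sphere)
    show "norm (q - ?z) = ?r" using q' by (simp add: dist_norm norm_minus_commute)
  qed (use a q in simp_all)
  also have "\<dots> = {v. v \<bullet> q = 0 \<and> v \<bullet> a = 0}" by (auto simp: inner_diff_right)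
  finally show ?thesis .
qed

context spherical_immersion
begin

text \<open>The inverse metric is positive definite: for scalars \<open>y\<close> the trace is the
  squared length of the tangent vector dual to \<open>y\<close>. Vector values are treated one basis
  component at a time.\<close>

lemma tr_square_eq_0:
  fixes v :: "'m \<Rightarrow> 'f::euclidean_space"
  assumes p: "p \<in> U" and tr0: "tr p (\<lambda>i j. v i \<bullet> v j) = 0"
  shows "v k = 0"
proof -
  have nn: "tr p (\<lambda>i j. y i * y j) \<ge> 0 \<and> (tr p (\<lambda>i j. y i * y j) = 0 \<longrightarrow> (\<forall>k. y k = 0))"
    for y :: "'m \<Rightarrow> real"
  proof -
    define w where "w = (\<Sum>k\<in>UNIV. (\<Sum>j\<in>UNIV. matrix_inv (induced_metric x p) $ k $ j * y j) *\<^sub>R pd k x p)"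
    have wx: "w \<bullet> pd l x p = y l" for l
    proof -
      have "w \<bullet> pd l x p = (\<Sum>k\<in>UNIV. \<Sum>j\<in>UNIV. y j * (g p l k * matrix_inv (induced_metric x p) $ k $ j))"
        by (simp add: w_def inner_sum_left sum_distrib_left sum_distrib_right ac_simps
            inner_commute[of "pd _ x p" "pd l x p"])
      also have "\<dots> = (\<Sum>j\<in>UNIV. y j * (\<Sum>k\<in>UNIV. g p l k * matrix_inv (induced_metric x p) $ k $ j))"
        by (subst sum.swap) (simp add: sum_distrib_left)
      also have "\<dots> = y l"
        by (simp add: metric_inverse[OF p] if_distrib cong: if_cong)
      finally show ?thesis .
    qed
    have "w \<bullet> w = (\<Sum>k\<in>UNIV. (\<Sum>j\<in>UNIV. matrix_inv (induced_metric x p) $ k $ j * y j) * y k)"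
      by (subst (2) w_def) (simp add: inner_sum_right wx)
    also have "\<dots> = tr p (\<lambda>i j. y i * y j)"
      by (simp add: metric_trace_def sum_distrib_left sum_distrib_right ac_simps)
    finally have "tr p (\<lambda>i j. y i * y j) = w \<bullet> w" by simp
    then show ?thesis using wx by auto
  qed
  have "tr p (\<lambda>i j. v i \<bullet> v j) = (\<Sum>b\<in>Basis. tr p (\<lambda>i j. (v i \<bullet> b) * (v j \<bullet> b)))"
  proof -
    have "(\<Sum>i\<in>UNIV. \<Sum>j\<in>UNIV. \<Sum>b\<in>Basis. F i j b) = (\<Sum>b\<in>Basis. \<Sum>i\<in>UNIV. \<Sum>j\<in>UNIV. F i j b)"
      for F :: "'m \<Rightarrow> 'm \<Rightarrow> 'f \<Rightarrow> real"
    proof -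
      have "(\<Sum>i\<in>UNIV. \<Sum>j\<in>UNIV. \<Sum>b\<in>Basis. F i j b) = (\<Sum>i\<in>UNIV. \<Sum>b\<in>Basis. \<Sum>j\<in>UNIV. F i j b)"
        by (intro sum.cong refl sum.swap)
      also have "\<dots> = (\<Sum>b\<in>Basis. \<Sum>i\<in>UNIV. \<Sum>j\<in>UNIV. F i j b)" by (rule sum.swap)
      finally show ?thesis .
    qed
    then show ?thesis
      unfolding metric_trace_def real_scaleR_def euclidean_inner[of "v _" "v _"] sum_distrib_left .
  qed
  then have "\<forall>b\<in>Basis. tr p (\<lambda>i j. (v i \<bullet> b) * (v j \<bullet> b)) = 0"
    using tr0 nn by (simp add: sum_nonneg_eq_0_iff)
  then have "v k \<bullet> b = 0" if "b \<in> Basis" for b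
    using nn[of "\<lambda>i. v i \<bullet> b"] that by blast
  then show ?thesis by (auto intro: euclidean_eqI[of "v k" 0])
qed

text \<open>Division-free form of: \<open>v\<close> is a multiple of \<open>u\<close> unless \<open>u = 0\<close>.\<close>

lemma normal_codim_1:
  assumes p: "p \<in> U" and dim: "DIM('e) = CARD('m) + 3"
    and h: "h \<noteq> 0" "h \<bullet> x p = 0" "\<And>l. h \<bullet> pd l x p = 0"
    and u: "u \<bullet> x p = 0" "\<And>l. u \<bullet> pd l x p = 0" "u \<bullet> h = 0"
    and v: "v \<bullet> x p = 0" "\<And>l. v \<bullet> pd l x p = 0" "v \<bullet> h = 0"
  shows "(u \<bullet> u) *\<^sub>R v = (u \<bullet> v) *\<^sub>R u"
proof (rule ccontr)
  assume contr: "\<not> ?thesis"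
  then have u0: "u \<noteq> 0" by auto
  \<comment> \<open>A multiple of the component of \<open>v\<close> orthogonal to \<open>u\<close>,
    nonzero by \<open>contr\<close>.\<close>
  define v' where "v' = (u \<bullet> u) *\<^sub>R v - (u \<bullet> v) *\<^sub>R u"
  have v0: "v' \<noteq> 0" using contr by (simp add: v'_def)
  have v': "v' \<bullet> x p = 0" "\<And>l. v' \<bullet> pd l x p = 0" "v' \<bullet> h = 0" "v' \<bullet> u = 0"
    using u v by (simp_all add: v'_def inner_diff_left inner_diff_right inner_commute)
  have x0: "x p \<noteq> 0" using x_x[OF p] by auto
  \<comment> \<open>These four nonzero orthogonal vectors and the tangent space would together span
    m + 4 dimensions inside m + 3.\<close>
  let ?A = "{x p, h, u, v'}" and ?T = "tangent_image x p"
  have ne: "x p \<noteq> h" "x p \<noteq> u" "x p \<noteq> v'" "h \<noteq> u" "h \<noteq> v'" "u \<noteq> v'"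
    using h u v' x0 u0 v0 by (auto simp: inner_commute)
  have "pairwise orthogonal ?A"
    using h u v' by (auto simp: pairwise_def orthogonal_def inner_commute)
  then have "independent ?A"
    using x0 h u0 v0 by (intro pairwise_orthogonal_independent) auto
  then have dA: "dim ?A = 4"
    using ne by (subst dim_eq_card_independent) auto
  have lin: "linear (frechet_derivative x (at p))"
    using smooth_on_imp_differentiable[OF smooth_x p] by (rule linear_frechet_derivative)
  have dT: "dim ?T = CARD('m)"
    unfolding tangent_image_def using dim_image_eq[OF lin, of UNIV] inj_dx[OF p]
    by (simp add: span_UNIV)
  have "dim (?A \<union> ?T) = dim ?A + dim ?T"
  proof (rule dim_orthogonal_sum)
    fix a b assume a: "a \<in> ?A" and "b \<in> ?T"
    then obtain c where b: "b = (\<Sum>k\<in>UNIV. (c $ k) *\<^sub>R pd k x p)" by (auto simp: tangent_image_eq[OF p])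
    have "a \<bullet> pd k x p = 0" for k
      using a h u v' dx_x[OF p, of k] by (auto simp: inner_commute)
    then show "a \<bullet> b = 0" by (simp add: b inner_sum_right)
  qed
  moreover have "dim (?A \<union> ?T) \<le> DIM('e)" by (rule dim_subset_UNIV)
  ultimately show False using dA dT dim by simp
qed

text \<open>The subtracted term \<open>a - q\<close> is the mean curvature at \<open>q\<close> of the small sphere itself.\<close>

lemma mean_curvature_hyperplane:
  assumes a: "a \<bullet> a = 2" and ax: "\<And>q. q \<in> U \<Longrightarrow> a \<bullet> x q = 1" and p: "p \<in> U"
  shows "mean_curvature (sphere 0 1 \<inter> {y. a \<bullet> y = 1}) x p = H p - (a - x p)"
proof -
  let ?S = "sphere 0 1 \<inter> {y. a \<bullet> y = 1}"
  \<comment> \<open>The unit normal at \<open>x p\<close> of the small sphere inside the unit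
    sphere.\<close>
  define \<nu> where "\<nu> = a - x p"
  have \<nu>: "\<nu> \<bullet> \<nu> = 1" "\<nu> \<bullet> x p = 0" "x p \<bullet> \<nu> = 0"
    using a ax[OF p] x_x[OF p] by (simp_all add: \<nu>_def inner_diff_left inner_diff_right inner_commute)
  have proj: "orth_proj (tangent_space ?S (x p)) v = v - (v \<bullet> x p) *\<^sub>R x p - (v \<bullet> \<nu>) *\<^sub>R \<nu>" (is "_ = ?w") for v
    unfolding tangent_space_hyperplane[OF a norm_x[OF p] ax[OF p]]
  proof (rule orth_proj_eqI)
    show "subspace {v. v \<bullet> x p = 0 \<and> v \<bullet> a = 0}"
      by (auto simp: subspace_def inner_add_left)
    have "?w \<bullet> x p = 0" "?w \<bullet> \<nu> = 0"
      using \<nu> x_x[OF p] by (simp_all add: inner_diff_left)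
    moreover have "a = \<nu> + x p" by (simp add: \<nu>_def)
    ultimately show "?w \<in> {v. v \<bullet> x p = 0 \<and> v \<bullet> a = 0}"
      by (simp add: inner_add_right)
    show "(v - ?w) \<bullet> u = 0" if "u \<in> {v. v \<bullet> x p = 0 \<and> v \<bullet> a = 0}" for u
      using that by (simp add: \<nu>_def inner_add_right inner_diff_right inner_commute)
  qed
  have adx: "a \<bullet> pd i x q = 0" if "q \<in> U" for i q
    using pd_inner_const[OF smooth_on_const smooth_x that ax, of i] by simp
  \<comment> \<open>Second derivative of \<open>a \<bullet> x = 1\<close>; consequently the
    component of the Hessian along \<open>\<nu>\<close> is \<open>g p i j\<close>.\<close>
  have addx: "pd i (pd j x) p \<bullet> a = 0" for i j
    using pd_inner_const[OF smooth_on_const smooth_dx p adx, of i j] by (simp add: inner_commute)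
  have "pullback_nabla ?S x i (pd j x) p = pd i (pd j x) p + g p i j *\<^sub>R x p - g p i j *\<^sub>R \<nu>" for i j
    using addx by (simp add: pullback_nabla_def proj ddx_x[OF p] \<nu>_def inner_diff_right)
  moreover have "orth_proj (tangent_image x p) (pd i (pd j x) p + g p i j *\<^sub>R x p - g p i j *\<^sub>R \<nu>)
      = (\<Sum>k\<in>UNIV. Gam p k i j *\<^sub>R pd k x p)" for i j
  proof (rule orth_proj_tangent_image[OF p refl])
    fix l
    have "\<nu> \<bullet> pd l x p = 0"
      using adx[OF p] dx_x[OF p, of l] by (simp add: \<nu>_def inner_diff_left inner_commute[of "x p"])
    then show "(pd i (pd j x) p + g p i j *\<^sub>R x p - g p i j *\<^sub>R \<nu>
        - (\<Sum>k\<in>UNIV. Gam p k i j *\<^sub>R pd k x p)) \<bullet> pd l x p = 0"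
      using B_dx[OF p, of i j l] by (simp add: B_def inner_diff_left inner_add_left)
  qed
  ultimately have "second_ff ?S x p = (\<lambda>i j. B p i j - g p i j *\<^sub>R \<nu>)"
    by (intro ext) (simp add: second_ff_def B_def)
  then show ?thesis
    by (simp add: mean_curvature_def[of ?S] metric_trace_diff metric_trace_scaleR_left tr_metric[OF p]
        tr_B[OF p] scaleR_diff_right \<nu>_def)
qed

text \<open>Here dH = - dx, so the Laplacian of \<open>H\<close> is minus that of \<open>x\<close>,
  namely m (x - H), and the terms of \<open>bitension_eq\<close> cancel.\<close>

lemma bitension_hyperplane:
  assumes H: "\<And>q. q \<in> U \<Longrightarrow> H q = a - x q" and p: "p \<in> U"
  shows "bitension (sphere 0 1) (induced_metric x) x p = 0"
proof -
  have dH: "pd j H q = - pd j x q" if q: "q \<in> U" for j q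
  proof -
    have "pd j H q = pd j (\<lambda>q. a - x q) q" by (rule pd_cong_open[OF open_U q H])
    then show ?thesis by (simp add: pd_diff smooth_on_imp_differentiable[OF smooth_x q])
  qed
  have ddH: "pd i (pd j H) p = - pd i (pd j x) p" for i j
  proof -
    have "pd i (pd j H) p = pd i (\<lambda>q. (-1) *\<^sub>R pd j x q) p"
      by (rule pd_cong_open[OF open_U p]) (simp add: dH)
    then show ?thesis
      using pd_cmult[OF smooth_on_imp_differentiable[OF smooth_dx p], of i "-1" j] by simp
  qed
  have "LH p = tr p (\<lambda>i j. g p i j *\<^sub>R x p - B p i j)"
    unfolding LH_def by (simp add: ddH dH[OF p] B_def sum_negf)
  also have "\<dots> = real CARD('m) *\<^sub>R x p - real CARD('m) *\<^sub>R H p"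
    by (simp add: metric_trace_diff metric_trace_scaleR_left tr_metric[OF p] tr_B[OF p])
  finally have "LH p = real CARD('m) *\<^sub>R x p - real CARD('m) *\<^sub>R H p" .
  moreover have "tr p (\<lambda>i j. pd j H p \<bullet> pd i x p) = - real CARD('m)"
    using tr_metric[OF p] by (simp add: dH[OF p] metric_trace_minus inner_commute)
  ultimately show ?thesis by (simp add: bitension_eq[OF p])
qed

end

section \<open>Pseudo-umbilical biharmonic immersions\<close>

locale umbilical_immersion = spherical_immersion x U
  for x :: "real ^ 'm::finite \<Rightarrow> 'e::euclidean_space" and U +
  fixes \<mu> :: "real ^ 'm \<Rightarrow> real"
  assumes smooth_\<mu>: "smooth_on \<mu> U"
    and shape: "p \<in> U \<Longrightarrow>
      shape_op (sphere 0 1) x (mean_curvature (sphere 0 1) x) p v = \<mu> p *\<^sub>R frechet_derivative x (at p) v"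
begin

text \<open>\<open>pd i H p\<close> is already tangent to the sphere, so the shape operator sees its
  whole tangential part, which is \<open>- \<mu> p\<close> times \<open>pd i x p\<close>.\<close>

lemma dH_dx_umbilical:
  assumes p: "p \<in> U"
  shows "pd i H p \<bullet> pd j x p = - (\<mu> p * g p i j)"
proof -
  have "orth_proj (tangent_space (sphere 0 1) (x p)) (pd i H p) = pd i H p"
    using dH_x[OF p] by (simp add: orth_proj_unit_sphere[OF norm_x[OF p]])
  then have "orth_proj (tangent_image x p) (pd i H p) = - (\<mu> p *\<^sub>R pd i x p)"
    using shape[OF p, of "axis i 1"] by (simp add: shape_op_def flip: pd_def) (metis minus_equation_iff)
  then show ?thesis
    using orth_proj_tangent_image_dot(1)[OF p, of "pd i H p" j] by simp
qed

lemma H_ddx: "p \<in> U \<Longrightarrow> H p \<bullet> pd i (pd j x) p = \<mu> p * g p i j"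
  using dH_dx dH_dx_umbilical by (metis neg_equal_iff_equal)

lemma B_H: "p \<in> U \<Longrightarrow> B p i j \<bullet> H p = \<mu> p * g p i j"
  using H_ddx[of p i j] by (simp add: B_inner H_x H_dx) (simp add: inner_commute)

lemma H_H:
  assumes p: "p \<in> U"
  shows "H p \<bullet> H p = \<mu> p"
proof -
  have "real CARD('m) * (H p \<bullet> H p) = tr p (B p) \<bullet> H p" by (simp add: tr_B[OF p])
  also have "\<dots> = \<mu> p * real CARD('m)"
    by (simp add: metric_trace_inner_left B_H[OF p] metric_trace_mult tr_metric[OF p])
  finally show ?thesis by simp
qed

lemma dH_H:
  assumes p: "p \<in> U"
  shows "pd k H p \<bullet> H p = pd k \<mu> p / 2"
proof -
  have "pd k (\<lambda>q. H q \<bullet> H q) p = pd k \<mu> p" by (rule pd_cong_open[OF open_U p H_H])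
  then show ?thesis
    by (simp add: pd_inner smooth_on_imp_differentiable[OF smooth_H p] inner_commute)
qed

text \<open>The Hessian differs from \<open>B\<close> by tangential terms, on which dH is known from
  umbilicity, and by a multiple of \<open>x p\<close>, to which dH is orthogonal.\<close>

lemma dH_ddx:
  assumes p: "p \<in> U"
  shows "pd k H p \<bullet> pd i (pd j x) p = pd k H p \<bullet> B p i j - \<mu> p * (pd i (pd j x) p \<bullet> pd k x p)"
proof -
  have "pd k H p \<bullet> B p i j = pd k H p \<bullet> pd i (pd j x) p + \<mu> p * (\<Sum>r\<in>UNIV. Gam p r i j * g p r k)"
    by (simp add: B_def inner_diff_right inner_add_right inner_sum_right dH_x[OF p]
        dH_dx_umbilical[OF p] sum_negf sum_distrib_left inner_commute[of "pd k x p"] ac_simps)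
  then show ?thesis by (simp add: christoffel_metric[OF p])
qed

lemma pd_mu_metric:
  assumes p: "p \<in> U"
  shows "pd k (\<lambda>q. \<mu> q * g q i j) p =
    \<mu> p * (pd k (pd i x) p \<bullet> pd j x p + pd i x p \<bullet> pd k (pd j x) p) + pd k \<mu> p * g p i j"
proof -
  have "(\<lambda>q. g q i j) differentiable (at p)"
    using smooth_on_inner[OF open_U smooth_dx smooth_dx] p by (rule smooth_on_imp_differentiable)
  then show ?thesis
    by (simp add: pd_mult pd_metric[OF p] smooth_on_imp_differentiable[OF smooth_\<mu> p])
qed

text \<open>Differentiate \<open>H_ddx\<close> in the direction \<open>k\<close> and exchange
  \<open>j\<close> and \<open>k\<close>: the third derivatives agree, and the products of
  \<open>\<mu>\<close> with second derivatives are symmetric in \<open>j\<close> and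
  \<open>k\<close>.\<close>

lemma codazzi:
  assumes p: "p \<in> U"
  shows "pd k \<mu> p * g p i j - pd k H p \<bullet> B p i j = pd j \<mu> p * g p i k - pd j H p \<bullet> B p i k"
proof -
  have *: "H p \<bullet> pd k (pd j (pd i x)) p + pd k H p \<bullet> B p j i =
      \<mu> p * (pd j (pd i x) p \<bullet> pd k x p + pd k (pd i x) p \<bullet> pd j x p + pd i x p \<bullet> pd k (pd j x) p)
      + pd k \<mu> p * g p i j" for j k
  proof -
    have "pd k (\<lambda>q. H q \<bullet> pd j (pd i x) q) p = pd k (\<lambda>q. \<mu> q * g q i j) p"
      by (rule pd_cong_open[OF open_U p]) (simp add: H_ddx inner_commute)
    then show ?thesis
      by (simp add: pd_inner smooth_on_imp_differentiable[OF smooth_H p]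
          smooth_on_imp_differentiable[OF smooth_ddx p] pd_mu_metric[OF p] dH_ddx[OF p] algebra_simps)
  qed
  have "pd k (pd j (pd i x)) p = pd j (pd k (pd i x)) p"
    by (rule pd_commute[OF open_U p smooth_dx])
  then show ?thesis
    using *[of k j] *[of j k] ddx_sym[OF p, of k j]
    by (simp add: B_sym[OF p, of i] inner_commute algebra_simps)
qed

text \<open>Differentiate \<open>dH_dx_umbilical\<close> once more: the Christoffel terms cancel,
  and contracting d\<mu> with the metric returns d\<mu>.\<close>

lemma LH_dx:
  assumes p: "p \<in> U"
  shows "LH p \<bullet> pd k x p = - pd k \<mu> p - tr p (\<lambda>i j. pd j H p \<bullet> B p i k)"
proof -
  have *: "(pd i (pd j H) p - (\<Sum>r\<in>UNIV. Gam p r i j *\<^sub>R pd r H p)) \<bullet> pd k x p =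
      - (pd i \<mu> p * g p j k) - pd j H p \<bullet> B p i k" for i j
  proof -
    have "pd i (\<lambda>q. pd j H q \<bullet> pd k x q) p = pd i (\<lambda>q. (-1) *\<^sub>R (\<mu> q * g q j k)) p"
      by (rule pd_cong_open[OF open_U p]) (simp add: dH_dx_umbilical)
    also have "\<dots> = - pd i (\<lambda>q. \<mu> q * g q j k) p"
    proof -
      have "(\<lambda>q. \<mu> q * g q j k) differentiable (at p)"
        using smooth_on_mult[OF open_U smooth_\<mu> smooth_on_inner[OF open_U smooth_dx smooth_dx]] p
        by (rule smooth_on_imp_differentiable)
      from pd_cmult[OF this, of i "-1"] show ?thesis by simp
    qed
    finally have 1: "pd j H p \<bullet> pd i (pd k x) p + pd i (pd j H) p \<bullet> pd k x p =
      - (\<mu> p * (pd i (pd j x) p \<bullet> pd k x p + pd j x p \<bullet> pd i (pd k x) p) + pd i \<mu> p * g p j k)"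
      by (simp add: pd_inner pd_mu_metric[OF p] smooth_on_imp_differentiable[OF smooth_dH p]
          smooth_on_imp_differentiable[OF smooth_dx p])
    have "(\<Sum>r\<in>UNIV. Gam p r i j *\<^sub>R pd r H p) \<bullet> pd k x p = - (\<mu> p * (\<Sum>r\<in>UNIV. Gam p r i j * g p r k))"
      by (simp add: inner_sum_left dH_dx_umbilical[OF p] sum_negf sum_distrib_left ac_simps)
    then show ?thesis
      using 1 dH_ddx[OF p, of j i k]
      by (simp add: christoffel_metric[OF p] inner_diff_left inner_commute algebra_simps)
  qed
  show ?thesis
    unfolding LH_def metric_trace_inner_left *
    by (simp add: metric_trace_diff metric_trace_minus tr_contract[OF p])
qed

text \<open>In this form the equation shows that \<open>LH\<close> has no tangential component and
  fixes its component along \<open>H\<close>; these are its two uses.\<close>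

lemma biharmonic_LH:
  assumes p: "p \<in> U" and bi: "bitension (sphere 0 1) (induced_metric x) x p = 0"
  shows "LH p = - (tr p (\<lambda>i j. pd j H p \<bullet> pd i x p) *\<^sub>R x p) - real CARD('m) *\<^sub>R H p"
proof -
  have "LH p + tr p (\<lambda>i j. pd j H p \<bullet> pd i x p) *\<^sub>R x p + real CARD('m) *\<^sub>R H p = 0"
    using bi by (simp add: bitension_eq[OF p])
  then show ?thesis by (simp add: eq_diff_eq eq_neg_iff_add_eq_0 ac_simps)
qed

text \<open>Tracing the Codazzi equation against the tangential part of the biharmonic equation
  leaves the factor \<open>m - 4\<close>.\<close>

lemma d\<mu>_eq_0:
  assumes p: "p \<in> U" and bi: "bitension (sphere 0 1) (induced_metric x) x p = 0" and m: "CARD('m) \<noteq> 4"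
  shows "pd k \<mu> p = 0"
proof -
  have "LH p \<bullet> pd k x p = 0"
    using H_dx[OF p] dx_x[OF p] by (simp add: biharmonic_LH[OF p bi] inner_diff_left inner_commute[of "x p"])
  then have 1: "tr p (\<lambda>i j. pd j H p \<bullet> B p i k) = - pd k \<mu> p"
    using LH_dx[OF p, of k] by simp
  have "tr p (\<lambda>i j. pd k \<mu> p * g p i j - pd k H p \<bullet> B p i j) =
      tr p (\<lambda>i j. pd j \<mu> p * g p i k - pd j H p \<bullet> B p i k)"
    by (simp add: codazzi[OF p, of k])
  moreover have "tr p (\<lambda>i j. pd k H p \<bullet> B p i j) = real CARD('m) * (pd k \<mu> p / 2)"
  proof -
    have "tr p (\<lambda>i j. pd k H p \<bullet> B p i j) = tr p (B p) \<bullet> pd k H p"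
      by (simp add: metric_trace_inner_left inner_commute)
    then show ?thesis using dH_H[OF p, of k] by (simp add: tr_B[OF p] inner_commute)
  qed
  \<comment> \<open>The two traces read m d\<mu> - (m/2) d\<mu> = d\<mu> + d\<mu>.\<close>
  ultimately have "(real CARD('m) - 4) * pd k \<mu> p = 0"
    using 1 by (simp add: metric_trace_diff metric_trace_mult tr_metric[OF p] tr_contract[OF p] algebra_simps)
  moreover have "real CARD('m) - 4 \<noteq> 0" using m by simp
  ultimately show ?thesis by simp
qed

text \<open>\<open>N i\<close> is the normal covariant derivative of \<open>H\<close>: the tangential part of \<open>pd i H\<close> is
  \<open>- \<mu> *\<^sub>R pd i x\<close>.\<close>

definition N where "N i p = pd i H p + \<mu> p *\<^sub>R pd i x p"

lemma N_x: "p \<in> U \<Longrightarrow> N i p \<bullet> x p = 0"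
  by (simp add: N_def inner_add_left dH_x dx_x)

lemma N_dx: "p \<in> U \<Longrightarrow> N i p \<bullet> pd j x p = 0"
  by (simp add: N_def inner_add_left dH_dx_umbilical)

lemma smooth_N: "smooth_on (N i) U"
  unfolding N_def[abs_def]
  by (intro smooth_on_add smooth_on_scaleR open_U smooth_dH smooth_dx smooth_\<mu>)

end

text \<open>\<open>c\<close> is a parameter because d\<mu> = 0 on a possibly disconnected chart
  image yields no constant; connectedness of the manifold later supplies one value for all
  charts.\<close>

locale biharmonic_cmc = umbilical_immersion x U \<mu>
  for x :: "real ^ 'm::finite \<Rightarrow> 'e::euclidean_space" and U \<mu> +
  fixes c :: real
  assumes \<mu>_eq: "p \<in> U \<Longrightarrow> \<mu> p = c"
    and biharmonic: "p \<in> U \<Longrightarrow> bitension (sphere 0 1) (induced_metric x) x p = 0"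
begin

lemma pd_\<mu>: "p \<in> U \<Longrightarrow> pd k \<mu> p = 0"
  using pd_cong_open[OF open_U, of p \<mu> "\<lambda>_. c" k] \<mu>_eq by simp

lemma dH_H0: "p \<in> U \<Longrightarrow> pd i H p \<bullet> H p = 0"
  by (simp add: dH_H pd_\<mu>)

lemma N_H: "p \<in> U \<Longrightarrow> N i p \<bullet> H p = 0"
  using H_dx by (simp add: N_def inner_add_left dH_H0 inner_commute[of "pd i x p"])

text \<open>Half the Laplacian of the constant |H|^2 is LH . H + |dH|^2, and the biharmonic equation
  evaluates the first summand as - m c.\<close>

lemma tr_dH:
  assumes p: "p \<in> U"
  shows "tr p (\<lambda>i j. pd i H p \<bullet> pd j H p) = real CARD('m) * c"
proof -
  have "(pd i (pd j H) p - (\<Sum>k\<in>UNIV. Gam p k i j *\<^sub>R pd k H p)) \<bullet> H p = - (pd i H p \<bullet> pd j H p)" for i j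
    using pd_inner_const[OF smooth_dH smooth_H p dH_H0, of i j]
    by (simp add: inner_diff_left inner_sum_left dH_H0[OF p] inner_commute[of "pd i H p" "pd j H p"])
  then have "LH p \<bullet> H p = tr p (\<lambda>i j. - (pd i H p \<bullet> pd j H p))"
    unfolding LH_def metric_trace_inner_left by presburger
  then have "LH p \<bullet> H p = - tr p (\<lambda>i j. pd i H p \<bullet> pd j H p)"
    by (simp only: metric_trace_minus)
  moreover have "LH p \<bullet> H p = - (real CARD('m) * c)"
    using H_x[OF p] by (simp add: biharmonic_LH[OF p biharmonic[OF p]] inner_diff_left
        inner_commute[of "x p"] H_H[OF p] \<mu>_eq[OF p])
  ultimately show ?thesis by simp
qed

text \<open>Pythagoras: from |dH|^2 = m c the tangential part - c dx takes away m c^2.\<close>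

lemma tr_N:
  assumes p: "p \<in> U"
  shows "tr p (\<lambda>i j. N i p \<bullet> N j p) = real CARD('m) * (c * (1 - c))"
proof -
  have *: "N i p \<bullet> N j p = pd i H p \<bullet> pd j H p - c\<^sup>2 * g p i j" for i j
    using dH_dx_umbilical[OF p, of j i]
    by (simp add: N_def inner_add_left inner_add_right dH_dx_umbilical[OF p] \<mu>_eq[OF p]
        inner_commute[of "pd i x p"] power2_eq_square)
  show ?thesis
    unfolding * by (simp add: metric_trace_diff metric_trace_mult tr_metric[OF p] tr_dH[OF p]
        power2_eq_square algebra_simps)
qed

text \<open>Codimension 2 enters here: the normal vectors orthogonal to \<open>H\<close> form a line, and on it the
  Codazzi equation makes the trace-free part of \<open>B\<close> a multiple of \<open>N\<^sub>i N\<^sub>j\<close>.\<close>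

lemma B_umbilical:
  assumes p: "p \<in> U" and dim: "DIM('e) = CARD('m) + 3" and c: "c \<noteq> 0" "c \<noteq> 1"
  shows "B p i j = g p i j *\<^sub>R H p"
proof -
  have "tr p (\<lambda>i j. N i p \<bullet> N j p) \<noteq> 0" using c by (simp add: tr_N[OF p])
  then obtain s where s: "N s p \<noteq> 0"
    by (force simp: metric_trace_def)
  have H0: "H p \<noteq> 0" using H_H[OF p] \<mu>_eq[OF p] c by auto
  \<comment> \<open>The trace-free part of \<open>B\<close>. It is normal and, by
    \<open>B_H\<close>, orthogonal to \<open>H\<close>, so it lies in the line spanned by
    \<open>N s p\<close>.\<close>
  define b where "b i j = B p i j - g p i j *\<^sub>R H p" for i j
  define h where "h i j = N s p \<bullet> b i j" for i j
  define w where "w i = N s p \<bullet> N i p" for i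
  have b: "b i j \<bullet> x p = 0" "b i j \<bullet> pd k x p = 0" "b i j \<bullet> H p = 0" for i j k
    using B_x[OF p] B_dx[OF p] B_H[OF p] H_x[OF p] H_dx[OF p] H_H[OF p]
    by (simp_all add: b_def inner_diff_left)
  have line: "(N s p \<bullet> N s p) *\<^sub>R v = (N s p \<bullet> v) *\<^sub>R N s p"
    if "v \<bullet> x p = 0" "\<And>l. v \<bullet> pd l x p = 0" "v \<bullet> H p = 0" for v
    by (rule normal_codim_1[OF p dim H0 H_x[OF p] H_dx[OF p]])
      (use that N_x[OF p] N_dx[OF p] N_H[OF p] in simp_all)
  have lb: "(N s p \<bullet> N s p) *\<^sub>R b i j = h i j *\<^sub>R N s p" for i j
    unfolding h_def by (rule line) (fact b)+
  have lN: "(N s p \<bullet> N s p) *\<^sub>R N i p = w i *\<^sub>R N s p" for i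
    unfolding w_def by (rule line) (use N_x[OF p] N_dx[OF p] N_H[OF p] in simp_all)
  have Nb: "N k p \<bullet> b i j = pd k H p \<bullet> B p i j" for k i j
    using B_dx[OF p, of i j k] H_dx[OF p, of k] dH_H0[OF p, of k]
    by (simp add: N_def b_def inner_add_left inner_diff_right inner_commute[of "pd k x p"])
  have cod: "N k p \<bullet> b i j = N j p \<bullet> b i k" for i j k
    using codazzi[OF p, of k i j] pd_\<mu>[OF p] by (simp add: Nb)
  have wh: "(N s p \<bullet> N s p) * (N k p \<bullet> b i j) = w k * h i j" for i j k
  proof -
    have "((N s p \<bullet> N s p) *\<^sub>R N k p) \<bullet> b i j = w k * h i j" by (simp add: lN h_def)
    then show ?thesis by simp
  qed
  \<comment> \<open>The Codazzi equation with d\<mu> = 0, in the coordinates \<open>w\<close> and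
    \<open>h\<close> along \<open>N s p\<close>.\<close>
  have ss: "w k * h i j = w j * h i k" for i j k
    using wh[of k i j] wh[of j i k] cod[of k i j] by simp
  have hsym: "h i j = h j i" for i j
    by (simp add: h_def b_def B_sym[OF p, of i] inner_commute[of "pd i x p"])
  have ws: "w s > 0" using s by (simp add: w_def)
  \<comment> \<open>Two uses of \<open>ss\<close> and the symmetry of \<open>h\<close> move both
    indices to \<open>s\<close>: \<open>h\<close> is a multiple of the product of \<open>w\<close>
    with itself.\<close>
  have hij: "(w s * w s) * h i j = (w i * w j) * h s s" for i j
  proof -
    have "(w s * w s) * h i j = w s * (w j * h i s)" using ss[of s i j] by simp
    also have "\<dots> = w j * (w s * h s i)" using hsym[of i s] by simp
    also have "\<dots> = w j * (w i * h s s)" using ss[of s s i] by simp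
    finally show ?thesis by simp
  qed
  have "tr p b = 0"
    unfolding b_def by (simp add: metric_trace_diff metric_trace_scaleR_left tr_metric[OF p] tr_B[OF p])
  then have "tr p (\<lambda>i j. h i j) = 0"
    unfolding h_def using metric_trace_inner_left[of "induced_metric x" p b "N s p"] by (simp add: inner_commute)
  then have "tr p (\<lambda>i j. (w s * w s) * h i j) = 0" by (simp add: metric_trace_mult)
  then have "h s s * tr p (\<lambda>i j. w i * w j) = 0"
    unfolding hij by (simp add: metric_trace_mult[symmetric] mult.commute)
  \<comment> \<open>This trace is \<open>N s p \<bullet> N s p\<close> times m c (1 - c), so
    trace-freeness can hold only if \<open>h s s = 0\<close>.\<close>
  moreover have "tr p (\<lambda>i j. w i * w j) \<noteq> 0"
  proof -
    have "w i * w j = (N s p \<bullet> N s p) * (N i p \<bullet> N j p)" for i j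
    proof -
      have "((N s p \<bullet> N s p) *\<^sub>R N i p) \<bullet> N j p = w i * w j" by (simp add: lN) (simp add: w_def)
      then show ?thesis by simp
    qed
    then show ?thesis using c s by (simp add: metric_trace_mult tr_N[OF p])
  qed
  ultimately have "h s s = 0" by simp
  then have "h i j = 0" using hij[of i j] ws by simp
  then have "b i j = 0" using lb[of i j] s by simp
  then show ?thesis by (simp add: b_def)
qed

text \<open>If \<open>c \<noteq> 1\<close>, then \<open>N \<noteq> 0\<close> everywhere by \<open>tr_N\<close>, hence \<open>B = g H\<close> identically. Differentiating
  \<open>N \<bullet> \<partial>\<partial>x = 0\<close> then contradicts the symmetry of the third derivatives.\<close>

lemma c_eq_1:
  assumes p: "p \<in> U" and dim: "DIM('e) = CARD('m) + 3" and m: "CARD('m) \<ge> 2" and c: "c \<noteq> 0"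
  shows "c = 1"
proof (rule ccontr)
  assume c1: "c \<noteq> 1"
  have "tr p (\<lambda>i j. N i p \<bullet> N j p) \<noteq> 0" using c c1 by (simp add: tr_N[OF p])
  then obtain s where s: "N s p \<noteq> 0"
    by (force simp: metric_trace_def)
  have ddx: "pd i (pd j x) q = (\<Sum>k\<in>UNIV. Gam q k i j *\<^sub>R pd k x q) + g q i j *\<^sub>R (H q - x q)"
    if q: "q \<in> U" for q i j
    using B_umbilical[OF q dim c c1, of i j] by (simp add: B_def algebra_simps)
  \<comment> \<open>By \<open>ddx\<close> the Hessian is a combination of the frame,
    \<open>H\<close> and \<open>x\<close>, all orthogonal to \<open>N s\<close>.\<close>
  have N0: "N s q \<bullet> pd j (pd i x) q = 0" if q: "q \<in> U" for q i j
    by (simp add: ddx[OF q] inner_add_right inner_diff_right inner_sum_right N_x[OF q] N_dx[OF q] N_H[OF q])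
  have dN: "pd k (N s) p \<bullet> x p = 0" "pd k (N s) p \<bullet> pd l x p = 0" "pd k (N s) p \<bullet> H p = - (N s p \<bullet> N k p)" for k l
  proof -
    show "pd k (N s) p \<bullet> x p = 0"
      using pd_inner_const[OF smooth_N smooth_x p N_x, of k s] by (simp add: N_dx[OF p])
    show "pd k (N s) p \<bullet> pd l x p = 0"
      using pd_inner_const[OF smooth_N smooth_dx p N_dx, of k s l] by (simp add: N0[OF p])
    have "pd k H p = N k p - \<mu> p *\<^sub>R pd k x p" by (simp add: N_def)
    then show "pd k (N s) p \<bullet> H p = - (N s p \<bullet> N k p)"
      using pd_inner_const[OF smooth_N smooth_H p N_H, of k s] by (simp add: N_dx[OF p] inner_diff_right)
  qed
  have d: "N s p \<bullet> pd k (pd j (pd i x)) p = g p j i * (N s p \<bullet> N k p)" for i j k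
    using pd_inner_const[OF smooth_N smooth_ddx p N0, of k j i]
    by (simp add: ddx[OF p] inner_add_right inner_diff_right inner_sum_right dN)
  \<comment> \<open>Symmetry of third derivatives in \<open>j\<close> and \<open>k\<close>. For k =
    s the trace over \<open>i\<close> and \<open>j\<close> equates m |N|^2 with |N|^2, where N is
    \<open>N s p\<close>.\<close>
  have "g p i j * (N s p \<bullet> N k p) = (N s p \<bullet> N j p) * g p i k" for i j k
    using d[of k j i] d[of j k i] pd_commute[OF open_U p smooth_dx, of k j i] by (simp add: inner_commute mult.commute)
  then have "tr p (\<lambda>i j. (N s p \<bullet> N s p) * g p i j) = tr p (\<lambda>i j. (N s p \<bullet> N j p) * g p i s)"
    by (simp add: mult.commute)
  then have "(N s p \<bullet> N s p) * real CARD('m) = N s p \<bullet> N s p"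
    by (simp add: metric_trace_mult tr_metric[OF p] tr_contract[OF p])
  then show False using s m by simp
qed

text \<open>For \<open>c = 1\<close> the trace in \<open>tr_N\<close> vanishes, and positivity of
  the inverse metric kills every \<open>N i p\<close>.\<close>

lemma dH_eq:
  assumes p: "p \<in> U" and c: "c = 1"
  shows "pd i H p = - pd i x p"
proof -
  have "N i p = 0" by (rule tr_square_eq_0[OF p]) (simp add: tr_N[OF p] c)
  then show ?thesis by (simp add: N_def \<mu>_eq[OF p] c eq_neg_iff_add_eq_0)
qed

end

section \<open>Independence of the chart\<close>

lemma pd_chain:
  fixes f :: "real ^ 'm::finite \<Rightarrow> 'b::real_normed_vector" and \<psi> :: "real ^ 'k::finite \<Rightarrow> real ^ 'm"
  assumes "\<psi> differentiable (at q)" "f differentiable (at (\<psi> q))"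
  shows "pd a (\<lambda>q. f (\<psi> q)) q = (\<Sum>i\<in>UNIV. (pd a \<psi> q $ i) *\<^sub>R pd i f (\<psi> q))"
    and "(\<lambda>q. f (\<psi> q)) differentiable (at q)"
proof -
  have "((\<lambda>q. f (\<psi> q)) has_derivative
      (\<lambda>v. frechet_derivative f (at (\<psi> q)) (frechet_derivative \<psi> (at q) v))) (at q)"
    using assms by (intro has_derivative_compose[of \<psi> _ _ _ f]) (auto simp: frechet_derivative_works[symmetric])
  from pd_eqI[OF this, of a] differentiableI[OF this]
  show "pd a (\<lambda>q. f (\<psi> q)) q = (\<Sum>i\<in>UNIV. (pd a \<psi> q $ i) *\<^sub>R pd i f (\<psi> q))"
    "(\<lambda>q. f (\<psi> q)) differentiable (at q)"
    by (simp_all add: frechet_derivative_eq_sum_pd[OF assms(2)] flip: pd_def)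
qed

lemma pd_sum:
  "finite I \<Longrightarrow> (\<And>i. i \<in> I \<Longrightarrow> f i differentiable (at p)) \<Longrightarrow>
    pd a (\<lambda>q. \<Sum>i\<in>I. f i q) p = (\<Sum>i\<in>I. pd a (f i) p)"
  by (induction I rule: finite_induct) (auto simp: pd_add differentiable_sum)

text \<open>Transformation law of the inverse metric under the change of frame \<open>A\<close>. The
  given \<open>N\<close> makes \<open>A\<close> right invertible, hence invertible; the second
  conclusion exhibits its left inverse.\<close>

lemma matrix_congruence_inverse:
  fixes A G M N :: "real ^ 'm::finite ^ 'm"
  assumes N: "(A ** G ** transpose A) ** N = mat 1" and M: "M ** G = mat 1"
  shows "transpose A ** N ** A = M" and "(G ** transpose A ** N) ** A = mat 1"
proof -
  have "A ** (G ** transpose A ** N) = mat 1"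
    using N by (simp add: matrix_mul_assoc)
  then show *: "(G ** transpose A ** N) ** A = mat 1"
    using matrix_left_right_inverse by blast
  have "transpose A ** N ** A = (M ** G) ** (transpose A ** N ** A)" by (simp add: M)
  also have "\<dots> = M ** ((G ** transpose A ** N) ** A)" by (simp add: matrix_mul_assoc)
  also have "\<dots> = M" by (simp add: *)
  finally show "transpose A ** N ** A = M" .
qed

text \<open>Both mean curvature vectors are normal to the same tangent space, so their difference is
  tested against itself. Normal components of second derivatives transform as a tensor, which avoids
  the transformation of Christoffel symbols.\<close>

lemma mean_curvature_reparametrize:
  fixes x y :: "real ^ 'm::finite \<Rightarrow> 'e::euclidean_space"
  assumes x: "spherical_immersion x U" and y: "spherical_immersion y W"
    and V: "open V" "V \<subseteq> W" and \<psi>: "smooth_on \<psi> V" "\<psi> ` V \<subseteq> U"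
    and yx: "\<And>q. q \<in> V \<Longrightarrow> y q = x (\<psi> q)" and p: "p \<in> V"
  shows "mean_curvature (sphere 0 1) y p = mean_curvature (sphere 0 1) x (\<psi> p)"
proof -
  interpret X: spherical_immersion x U by fact
  interpret Y: spherical_immersion y W by fact
  have pW: "p \<in> W" and pU: "\<psi> p \<in> U" using p V \<psi> by auto
  have d\<psi>: "\<psi> differentiable (at q)" if "q \<in> V" for q
    using \<psi>(1) that by (rule smooth_on_imp_differentiable)
  have dy: "pd a y q = (\<Sum>i\<in>UNIV. (pd a \<psi> q $ i) *\<^sub>R pd i x (\<psi> q))" if q: "q \<in> V" for a q
  proof -
    have "pd a y q = pd a (\<lambda>q. x (\<psi> q)) q" by (rule pd_cong_open[OF V(1) q yx])
    then show ?thesis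
      using pd_chain(1)[OF d\<psi>[OF q]] smooth_on_imp_differentiable[OF X.smooth_x] \<psi>(2) q
      by fastforce
  qed
  \<comment> \<open>Because \<open>v\<close> is normal, the second derivatives of
    \<open>\<psi>\<close> drop out.\<close>
  have ddy: "pd b (pd a y) p \<bullet> v =
      (\<Sum>i\<in>UNIV. \<Sum>j\<in>UNIV. (pd a \<psi> p $ i) * (pd b \<psi> p $ j) * (pd j (pd i x) (\<psi> p) \<bullet> v))"
    if v: "\<And>i. pd i x (\<psi> p) \<bullet> v = 0" for a b v
  proof -
    have dd\<psi>: "(\<lambda>q. pd a \<psi> q $ i) differentiable (at p)" for i
      unfolding cart_eq_inner_axis
      by (rule smooth_on_imp_differentiable[OF smooth_on_inner[OF V(1) smooth_on_pd[OF \<psi>(1)] smooth_on_const] p])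
    have ddx: "(\<lambda>q. pd i x (\<psi> q)) differentiable (at p)" for i
      by (rule pd_chain(2)[OF d\<psi>[OF p] smooth_on_imp_differentiable[OF X.smooth_dx pU]])
    have "pd b (pd a y) p = pd b (\<lambda>q. \<Sum>i\<in>UNIV. (pd a \<psi> q $ i) *\<^sub>R pd i x (\<psi> q)) p"
      by (rule pd_cong_open[OF V(1) p dy])
    also have "\<dots> = (\<Sum>i\<in>UNIV. pd b (\<lambda>q. (pd a \<psi> q $ i) *\<^sub>R pd i x (\<psi> q)) p)"
      by (intro pd_sum differentiable_scaleR dd\<psi> ddx) simp
    also have "\<dots> = (\<Sum>i\<in>UNIV. (pd a \<psi> p $ i) *\<^sub>R (\<Sum>j\<in>UNIV. (pd b \<psi> p $ j) *\<^sub>R pd j (pd i x) (\<psi> p))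
        + pd b (\<lambda>q. pd a \<psi> q $ i) p *\<^sub>R pd i x (\<psi> p))"
      by (simp add: pd_scaleR[OF dd\<psi> ddx]
          pd_chain(1)[OF d\<psi>[OF p] smooth_on_imp_differentiable[OF X.smooth_dx pU]])
    finally show ?thesis
      by (simp add: inner_sum_left inner_add_left v sum_distrib_left mult.assoc)
  qed
  define A where "A = (\<chi> a i. pd a \<psi> p $ i)"
  define G where "G = induced_metric x (\<psi> p)"
  define Ny where "Ny = matrix_inv (induced_metric y p)"
  have "induced_metric y p = A ** G ** transpose A"
  proof -
    have "Y.g p a b = (\<Sum>j\<in>UNIV. (\<Sum>i\<in>UNIV. (pd a \<psi> p $ i) * X.g (\<psi> p) i j) * (pd b \<psi> p $ j))" for a b
      by (simp add: dy[OF p] inner_sum_left inner_sum_right sum_distrib_left sum_distrib_right ac_simps)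
    then show ?thesis
      by (simp add: vec_eq_iff induced_metric_def A_def G_def matrix_matrix_mult_def transpose_def)
  qed
  then have inv: "(A ** G ** transpose A) ** Ny = mat 1"
    using matrix_inv_inverse(1)[OF Y.invertible_metric[OF pW]] by (simp add: Ny_def)
  have inv2: "matrix_inv G ** G = mat 1"
    unfolding G_def by (rule matrix_inv_inverse(2)[OF X.invertible_metric[OF pU]])
  note AN = matrix_congruence_inverse[OF inv inv2]
  have tr: "Y.tr p (\<lambda>a b. \<Sum>i\<in>UNIV. \<Sum>j\<in>UNIV. (pd a \<psi> p $ i) * (pd b \<psi> p $ j) * h i j) = X.tr (\<psi> p) h"
    for h :: "'m \<Rightarrow> 'm \<Rightarrow> real"
  proof -
    have M: "matrix_inv G $ i $ j = (\<Sum>a\<in>UNIV. \<Sum>b\<in>UNIV. Ny $ a $ b * (A $ a $ i * A $ b $ j))" for i j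
      unfolding AN(1)[symmetric] matrix_matrix_mult_def transpose_def
      by (subst sum.swap) (simp add: sum_distrib_left sum_distrib_right ac_simps)
    have "X.tr (\<psi> p) h = (\<Sum>i\<in>UNIV. \<Sum>j\<in>UNIV. \<Sum>a\<in>UNIV. \<Sum>b\<in>UNIV. Ny $ a $ b * (A $ a $ i * A $ b $ j * h i j))"
      by (simp add: metric_trace_def M flip: G_def) (simp add: sum_distrib_left sum_distrib_right ac_simps)
    also have "\<dots> = (\<Sum>i\<in>UNIV. \<Sum>a\<in>UNIV. \<Sum>j\<in>UNIV. \<Sum>b\<in>UNIV. Ny $ a $ b * (A $ a $ i * A $ b $ j * h i j))"
      by (intro sum.cong refl sum.swap)
    also have "\<dots> = (\<Sum>a\<in>UNIV. \<Sum>i\<in>UNIV. \<Sum>b\<in>UNIV. \<Sum>j\<in>UNIV. Ny $ a $ b * (A $ a $ i * A $ b $ j * h i j))"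
      by (subst sum.swap) (intro sum.cong refl sum.swap)
    also have "\<dots> = (\<Sum>a\<in>UNIV. \<Sum>b\<in>UNIV. \<Sum>i\<in>UNIV. \<Sum>j\<in>UNIV. Ny $ a $ b * (A $ a $ i * A $ b $ j * h i j))"
      by (intro sum.cong refl sum.swap)
    also have "\<dots> = Y.tr p (\<lambda>a b. \<Sum>i\<in>UNIV. \<Sum>j\<in>UNIV. (pd a \<psi> p $ i) * (pd b \<psi> p $ j) * h i j)"
      by (simp add: metric_trace_def Ny_def A_def sum_distrib_left)
    finally show ?thesis by simp
  qed
  \<comment> \<open>The inverse Jacobian from \<open>AN(2)\<close> writes the frame of
    \<open>x\<close> in that of \<open>y\<close>, so \<open>Y.H p\<close> is normal to the former as
    well.\<close>
  have dx: "pd i x (\<psi> p) = (\<Sum>a\<in>UNIV. (G ** transpose A ** Ny) $ i $ a *\<^sub>R pd a y p)" for i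
  proof -
    let ?C = "G ** transpose A ** Ny"
    have AA: "A $ a $ k = pd a \<psi> p $ k" for a k by (simp add: A_def)
    have C: "(\<Sum>a\<in>UNIV. ?C $ i $ a * (pd a \<psi> p $ k)) = (if i = k then 1 else 0)" for k
    proof -
      have "(?C ** A) $ i $ k = mat 1 $ i $ k" using AN(2) by simp
      then show ?thesis
        by (simp only: matrix_matrix_mult_def[of ?C A] mat_def vec_lambda_beta AA)
    qed
    have "(\<Sum>a\<in>UNIV. ?C $ i $ a *\<^sub>R pd a y p) =
        (\<Sum>a\<in>UNIV. \<Sum>k\<in>UNIV. (?C $ i $ a * (pd a \<psi> p $ k)) *\<^sub>R pd k x (\<psi> p))"
      by (simp add: dy[OF p] scaleR_sum_right)
    also have "\<dots> = (\<Sum>k\<in>UNIV. (\<Sum>a\<in>UNIV. ?C $ i $ a * (pd a \<psi> p $ k)) *\<^sub>R pd k x (\<psi> p))"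
      by (subst sum.swap) (simp add: scaleR_sum_left)
    also have "\<dots> = pd i x (\<psi> p)"
      unfolding C by (simp add: if_distrib[of "\<lambda>r. r *\<^sub>R _"] cong: if_cong)
    finally show ?thesis by simp
  qed
  define v where "v = Y.H p - X.H (\<psi> p)"
  have Hy: "Y.H p \<bullet> pd i x (\<psi> p) = 0" for i
    by (simp add: dx inner_sum_right Y.H_dx[OF pW])
  have vx: "v \<bullet> pd i x (\<psi> p) = 0" "v \<bullet> x (\<psi> p) = 0" for i
    using Hy X.H_dx[OF pU] X.H_x[OF pU] Y.H_x[OF pW] yx[OF p] by (simp_all add: v_def inner_diff_left)
  have vy: "v \<bullet> pd a y p = 0" "v \<bullet> y p = 0" for a
    using vx yx[OF p] by (simp_all add: dy[OF p] inner_sum_right)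
  have "real CARD('m) * (Y.H p \<bullet> v) = Y.tr p (\<lambda>a b. pd a (pd b y) p \<bullet> v)"
    using Y.B_inner[OF pW vy(2,1)] Y.tr_B[OF pW] metric_trace_inner_left[of "induced_metric y" p "Y.B p" v] by simp
  also have "\<dots> = Y.tr p (\<lambda>a b. pd b (pd a y) p \<bullet> v)"
    by (simp add: Y.ddx_sym[OF pW])
  also have "\<dots> = X.tr (\<psi> p) (\<lambda>i j. pd j (pd i x) (\<psi> p) \<bullet> v)"
  proof -
    have "pd i x (\<psi> p) \<bullet> v = 0" for i using vx(1) by (simp add: inner_commute)
    then show ?thesis by (simp only: ddy tr)
  qed
  also have "\<dots> = X.tr (\<psi> p) (\<lambda>i j. pd i (pd j x) (\<psi> p) \<bullet> v)"
    by (simp add: X.ddx_sym[OF pU])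
  also have "\<dots> = real CARD('m) * (X.H (\<psi> p) \<bullet> v)"
    using X.B_inner[OF pU vx(2,1)] X.tr_B[OF pU] metric_trace_inner_left[of "induced_metric x" "\<psi> p" "X.B (\<psi> p)" v] by simp
  finally have "v \<bullet> v = 0" by (simp add: v_def inner_diff_left)
  then show ?thesis by (simp add: v_def)
qed

section \<open>From charts to the manifold\<close>

text \<open>The definition leaves normal, offset and centre free; at this radius the centre
  \<open>z\<close> must be parallel to the normal with squared norm 1/2, and \<open>a\<close> is
  twice \<open>z\<close>.\<close>

lemma hypersphere_normal_form:
  fixes S :: "'e::euclidean_space set"
  assumes S: "hypersphere_of_unit_sphere (1 / sqrt 2) S" and dim: "2 \<le> DIM('e)"
  obtains a where "a \<bullet> a = 2" "S = sphere 0 1 \<inter> {y. a \<bullet> y = 1}"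
proof -
  obtain n b z where n: "n \<noteq> 0" "n \<bullet> z = b" and S1: "S = sphere 0 1 \<inter> {y. n \<bullet> y = b}"
    and S2: "S = sphere z (1 / sqrt 2) \<inter> {y. n \<bullet> y = b}"
    using S unfolding hypersphere_of_unit_sphere_def by blast
  have orth: "z \<bullet> u = 0 \<and> z \<bullet> z = 1 / 2" if u: "n \<bullet> u = 0" "u \<noteq> 0" for u
  proof -
    \<comment> \<open>z + w and z - w are opposite points of \<open>S\<close>. That both have norm 1
      gives \<open>z \<bullet> w = 0\<close> and, since |w|^2 = 1/2, the norm of
      \<open>z\<close>.\<close>
    define w where "w = (1 / (sqrt 2 * norm u)) *\<^sub>R u"
    have ww: "w \<bullet> w = 1 / 2"
      using u by (simp add: w_def dot_square_norm power2_eq_square)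
    have nw: "norm w = 1 / sqrt 2" unfolding norm_eq_sqrt_inner ww by (simp add: real_sqrt_divide)
    have nw0: "n \<bullet> w = 0" using u by (simp add: w_def)
    have "z + w \<in> S" "z - w \<in> S"
      unfolding S2 using n nw nw0 by (simp_all add: dist_norm inner_add_right inner_diff_right)
    then have "norm (z + w) = 1" "norm (z - w) = 1" unfolding S1 by auto
    then have "(z + w) \<bullet> (z + w) = 1" "(z - w) \<bullet> (z - w) = 1" by (simp_all add: dot_square_norm)
    then have "z \<bullet> z + 2 * (z \<bullet> w) + w \<bullet> w = 1" "z \<bullet> z - 2 * (z \<bullet> w) + w \<bullet> w = 1"
      by (simp_all add: inner_add_left inner_add_right inner_diff_left inner_diff_right inner_commute)
    then have "z \<bullet> w = 0" "z \<bullet> z = 1 / 2" using ww by auto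
    then show ?thesis using u by (simp add: w_def)
  qed
  obtain u where "u \<noteq> 0" "orthogonal n u" using orthogonal_to_vector_exists[OF dim] by metis
  then have zz: "z \<bullet> z = 1 / 2" using orth by (simp add: orthogonal_def)
  define k where "k = (z \<bullet> n) / (n \<bullet> n)"
  have nn: "n \<bullet> n \<noteq> 0" using n by simp
  \<comment> \<open>The part of \<open>z\<close> orthogonal to \<open>n\<close> is orthogonal to
    \<open>z\<close> by \<open>orth\<close>, hence to itself.\<close>
  have "z - k *\<^sub>R n = 0"
  proof (rule ccontr)
    assume ne: "z - k *\<^sub>R n \<noteq> 0"
    have nz: "n \<bullet> (z - k *\<^sub>R n) = 0" using nn by (simp add: k_def inner_diff_right inner_commute)
    then have "z \<bullet> (z - k *\<^sub>R n) = 0" using orth ne by blast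
    with nz have "(z - k *\<^sub>R n) \<bullet> (z - k *\<^sub>R n) = 0" by (simp add: inner_diff_left)
    then show False using ne by simp
  qed
  then have z: "z = k *\<^sub>R n" by simp
  then have k: "k \<noteq> 0" using zz by auto
  have "n \<bullet> y = b \<longleftrightarrow> (2 *\<^sub>R z) \<bullet> y = 1" for y
  proof -
    have "n \<bullet> y = b \<longleftrightarrow> k * (n \<bullet> y) = k * (n \<bullet> z)" using k n by simp
    also have "\<dots> \<longleftrightarrow> z \<bullet> y = 1 / 2" using zz z by (metis inner_scaleR_left)
    finally show ?thesis by auto
  qed
  then have "S = sphere 0 1 \<inter> {y. (2 *\<^sub>R z) \<bullet> y = 1}" unfolding S1 by auto
  moreover have "(2 *\<^sub>R z) \<bullet> (2 *\<^sub>R z) = 2" using zz by simp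
  ultimately show ?thesis using that by blast
qed

lemma hypersphere_of_unit_sphereI:
  fixes a :: "'e::euclidean_space"
  assumes a: "a \<bullet> a = 2"
  shows "hypersphere_of_unit_sphere (1 / sqrt 2) (sphere 0 1 \<inter> {y. a \<bullet> y = 1})"
  unfolding hypersphere_of_unit_sphere_def
proof (intro conjI exI)
  show "sphere 0 1 \<inter> {y. a \<bullet> y = 1} = sphere ((1/2) *\<^sub>R a) (1 / sqrt 2) \<inter> {y. a \<bullet> y = 1}"
    by (rule small_hypersphere_eq[OF a])
qed (use a in auto)

section \<open>Charts, and functions on a connected manifold\<close>

lemma
  assumes M: "smooth_manifold T \<A>" and c: "c \<in> \<A>"
  shows chart_domain: "openin T (fst c)" "fst c \<subseteq> topspace T"
    and open_chart_image: "open (chart_image c)"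
    and continuous_chart: "continuous_map (subtopology T (fst c)) (top_of_set (chart_image c)) (snd c)"
    and open_map_chart: "open_map (subtopology T (fst c)) (top_of_set (chart_image c)) (snd c)"
    and inj_on_chart: "inj_on (snd c) (fst c)"
proof -
  have *: "homeomorphic_map (subtopology T (fst c)) (top_of_set (chart_image c)) (snd c)"
    using M c by (auto simp: smooth_manifold_def)
  show o: "openin T (fst c)" "open (chart_image c)"
    using M c by (auto simp: smooth_manifold_def)
  show s: "fst c \<subseteq> topspace T" using o(1) by (rule openin_subset)
  show "continuous_map (subtopology T (fst c)) (top_of_set (chart_image c)) (snd c)"
    "open_map (subtopology T (fst c)) (top_of_set (chart_image c)) (snd c)"
    using * by (auto intro: homeomorphic_imp_continuous_map homeomorphic_imp_open_map)
  show "inj_on (snd c) (fst c)"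
    using homeomorphic_imp_injective_map[OF *] s by (simp add: Int_absorb1)
qed

lemma in_chart_apply:
  assumes "smooth_manifold T \<A>" "c \<in> \<A>" "m \<in> fst c"
  shows "in_chart c f (snd c m) = f m"
  using inj_on_chart[OF assms(1,2)] assms(3) by (simp add: in_chart_def)

lemma chart_imageE:
  assumes "p \<in> chart_image c"
  obtains m where "m \<in> fst c" "snd c m = p"
  using assms by (auto simp: chart_image_def)

lemma manifold_coverE:
  assumes "smooth_manifold T \<A>" "m \<in> topspace T"
  obtains c where "c \<in> \<A>" "m \<in> fst c" "snd c m \<in> chart_image c"
proof -
  have "m \<in> (\<Union>c\<in>\<A>. fst c)" using assms by (simp add: smooth_manifold_def)
  then obtain c where "c \<in> \<A>" "m \<in> fst c" by blast
  then show ?thesis using that by (simp add: chart_image_def)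
qed

text \<open>Vanishing partial derivatives make \<open>F\<close> constant on a ball in a chart, so
  its level sets are open and closed. Applied to the umbilicity factor and to \<phi> + H.\<close>

lemma constant_on_connected_manifold:
  fixes F :: "'a \<Rightarrow> 'b::real_normed_vector" and \<A> :: "('a, 'm::finite) chart set"
  assumes M: "smooth_manifold T \<A>" and conn: "connected_space T"
    and F: "\<And>c p. c \<in> \<A> \<Longrightarrow> p \<in> chart_image c \<Longrightarrow> in_chart c F differentiable (at p)"
    and F0: "\<And>c p k. c \<in> \<A> \<Longrightarrow> p \<in> chart_image c \<Longrightarrow> pd k (in_chart c F) p = 0"
    and m: "m \<in> topspace T" "m' \<in> topspace T"
  shows "F m = F m'"
proof -
  have loc: "\<exists>W. openin T W \<and> m \<in> W \<and> (\<forall>m'\<in>W. F m' = F m)" if mT: "m \<in> topspace T" for m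
  proof -
    obtain c where c: "c \<in> \<A>" "m \<in> fst c" "snd c m \<in> chart_image c"
      using manifold_coverE[OF M mT] by metis
    then obtain e where e: "e > 0" "ball (snd c m) e \<subseteq> chart_image c"
      using open_chart_image[OF M c(1)] openE by blast
    have "\<exists>k. \<forall>p\<in>ball (snd c m) e. in_chart c F p = k"
    proof (rule has_derivative_zero_constant)
      fix p assume "p \<in> ball (snd c m) e"
      then have p: "p \<in> chart_image c" using e by auto
      have "frechet_derivative (in_chart c F) (at p) = (\<lambda>v. 0)"
        using frechet_derivative_eq_sum_pd[OF F[OF c(1) p]] F0[OF c(1) p] by auto
      then show "(in_chart c F has_derivative (\<lambda>h. 0)) (at p within ball (snd c m) e)"
        using F[OF c(1) p] by (metis frechet_derivative_works has_derivative_at_withinI)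
    qed simp
    then have const: "in_chart c F p = F m" if "p \<in> ball (snd c m) e" for p
      using in_chart_apply[OF M c(1,2), of F] e(1) that by (metis centre_in_ball)
    define W where "W = {m' \<in> topspace (subtopology T (fst c)). snd c m' \<in> ball (snd c m) e}"
    have "openin (top_of_set (chart_image c)) (ball (snd c m) e)"
      using e open_chart_image[OF M c(1)] by (simp add: openin_open_eq)
    then have "openin (subtopology T (fst c)) W"
      unfolding W_def by (rule openin_continuous_map_preimage[OF continuous_chart[OF M c(1)]])
    then have "openin T W"
      using chart_domain(1)[OF M c(1)] by (simp add: openin_open_subtopology)
    moreover have "m \<in> W" using c e mT by (simp add: W_def)
    moreover have "F m' = F m" if "m' \<in> W" for m'
      using that const in_chart_apply[OF M c(1), of m' F] by (auto simp: W_def)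
    ultimately show ?thesis by blast
  qed
  let ?E = "{m' \<in> topspace T. F m' = F m}"
  have "openin T {m' \<in> topspace T. P (F m')}" for P
  proof (subst openin_subopen, intro ballI)
    fix m' assume m': "m' \<in> {m' \<in> topspace T. P (F m')}"
    then obtain W where W: "openin T W" "m' \<in> W" "\<forall>y\<in>W. F y = F m'" using loc by blast
    have "W \<subseteq> {m' \<in> topspace T. P (F m')}"
    proof
      fix y assume "y \<in> W"
      then have "F y = F m'" "y \<in> topspace T" using W openin_subset by blast+
      with m' show "y \<in> {m' \<in> topspace T. P (F m')}" by simp
    qed
    with W show "\<exists>W. openin T W \<and> m' \<in> W \<and> W \<subseteq> {m' \<in> topspace T. P (F m')}" by blast
  qed
  from this[of "\<lambda>y. y = F m"] this[of "\<lambda>y. y \<noteq> F m"]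
  have "openin T ?E" "openin T {m' \<in> topspace T. F m' \<noteq> F m}" by auto
  moreover have "topspace T - ?E = {m' \<in> topspace T. F m' \<noteq> F m}" by auto
  ultimately have "openin T ?E \<and> closedin T ?E" by (simp add: closedin_def)
  then have "?E = {} \<or> ?E = topspace T"
    using conn unfolding connected_space_clopen_in by blast
  then have "?E = topspace T" using m(1) by auto
  then have "m' \<in> ?E" using m(2) by blast
  then show ?thesis by simp
qed

lemma spherical_immersion_in_chart:
  assumes sub: "submanifold (sphere 0 1) T \<A> \<phi>" and c: "c \<in> \<A>"
  shows "spherical_immersion (in_chart c \<phi>) (chart_image c)"
proof
  have M: "smooth_manifold T \<A>" using sub by (simp add: submanifold_def)
  show "open (chart_image c)" by (rule open_chart_image[OF M c])
  show "smooth_on (in_chart c \<phi>) (chart_image c)"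
    using sub c by (auto simp: submanifold_def immersion_def smooth_map_def)
  fix p assume p: "p \<in> chart_image c"
  show "inj (frechet_derivative (in_chart c \<phi>) (at p))"
    using sub c p by (auto simp: submanifold_def immersion_def)
  obtain m where m: "m \<in> fst c" "snd c m = p" using chart_imageE[OF p] by metis
  then have "in_chart c \<phi> p = \<phi> m" using in_chart_apply[OF M c] by metis
  moreover have "m \<in> topspace T" using m(1) chart_domain(2)[OF M c] by blast
  then have "\<phi> m \<in> sphere 0 1" using sub unfolding submanifold_def by blast
  ultimately show "norm (in_chart c \<phi> p) = 1" by simp
qed

text \<open>The reparametrization is the transition map on the overlap. This is what turns \<phi> +
  H into a function on the manifold.\<close>

lemma mean_curvature_chart_independent:
  assumes sub: "submanifold (sphere 0 1) T \<A> \<phi>" and c: "c \<in> \<A>" "m \<in> fst c" and d: "d \<in> \<A>" "m \<in> fst d"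
  shows "mean_curvature (sphere 0 1) (in_chart d \<phi>) (snd d m) =
    mean_curvature (sphere 0 1) (in_chart c \<phi>) (snd c m)"
proof -
  have M: "smooth_manifold T \<A>" using sub by (simp add: submanifold_def)
  let ?V = "snd d ` (fst d \<inter> fst c)" and ?\<psi> = "in_chart d (snd c)"
  have "openin (subtopology T (fst d)) (fst d \<inter> fst c)"
    using chart_domain(1)[OF M c(1)] chart_domain(1)[OF M d(1)] by (simp add: openin_open_subtopology openin_Int)
  then have "openin (top_of_set (chart_image d)) ?V"
    using open_map_chart[OF M d(1)] by (simp add: open_map_def)
  then have V: "open ?V" "?V \<subseteq> chart_image d"
    using open_chart_image[OF M d(1)] by (simp_all add: openin_open_eq)
  have "smooth_on ?\<psi> ?V" using M c d by (simp add: smooth_manifold_def)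
  moreover have "?\<psi> ` ?V \<subseteq> chart_image c"
    using in_chart_apply[OF M d(1), of _ "snd c"] by (auto simp: chart_image_def)
  moreover have "in_chart d \<phi> q = in_chart c \<phi> (?\<psi> q)" if "q \<in> ?V" for q
    using that by (auto simp: in_chart_apply[OF M d(1)] in_chart_apply[OF M c(1)])
  moreover have "snd d m \<in> ?V" using c d by auto
  ultimately have "mean_curvature (sphere 0 1) (in_chart d \<phi>) (snd d m) =
    mean_curvature (sphere 0 1) (in_chart c \<phi>) (?\<psi> (snd d m))"
    by (intro mean_curvature_reparametrize[OF spherical_immersion_in_chart[OF sub c(1)]
          spherical_immersion_in_chart[OF sub d(1)] V])
  then show ?thesis using in_chart_apply[OF M d] by metis
qed

text \<open>Without connectedness, different components could lie in different hyperspheres;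
  nonemptiness gives a point where harmonicity can fail. Curves are excluded because
  pseudo-umbilicity says nothing about them.\<close>

theorem theorem5p3:
  fixes T :: "'a topology"
    and \<A> :: "('a, 'm::finite) chart set"
    and \<phi> :: "'a \<Rightarrow> real ^ 'n::finite"
  assumes "CARD('n) = CARD('m) + 3"
    and "CARD('m) \<ge> 2"
    and "CARD('m) \<noteq> 4"
    and "connected_space T"
    and "topspace T \<noteq> {}"
    and "submanifold (sphere 0 1) T \<A> \<phi>"
    and "pseudo_umbilical (sphere 0 1) \<A> \<phi>"
  shows "proper_biharmonic (sphere 0 1) \<A> \<phi> \<longleftrightarrow>
    (\<exists>S. hypersphere_of_unit_sphere (1 / sqrt 2) S \<and>
       submanifold S T \<A> \<phi> \<and> minimal S \<A> \<phi>)"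
proof
  note sub = assms(6)
  have M: "smooth_manifold T \<A>" using sub by (simp add: submanifold_def)
  note chart = spherical_immersion_in_chart[OF sub]
  let ?X = "\<lambda>c. in_chart c \<phi>" and ?H = "\<lambda>c. mean_curvature (sphere 0 1) (in_chart c \<phi>)"
  have dim: "DIM(real ^ 'n) = CARD('m) + 3" using assms(1) by simp
  {
    assume "proper_biharmonic (sphere 0 1) \<A> \<phi>"
    then have bi: "bitension (sphere 0 1) (induced_metric (?X c)) (?X c) p = 0"
      if "c \<in> \<A>" "p \<in> chart_image c" for c p
      using that by (auto simp: proper_biharmonic_def biharmonic_map_def pullback_metric_def)
    \<comment> \<open>Non-harmonicity is known at one point only; the constant is shown to be 1
      there and carries over to all charts.\<close>
    obtain d p0 where d: "d \<in> \<A>" "p0 \<in> chart_image d"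
      and nonharm: "tension (sphere 0 1) (induced_metric (?X d)) (?X d) p0 \<noteq> 0"
      using \<open>proper_biharmonic (sphere 0 1) \<A> \<phi>\<close>
      by (auto simp: proper_biharmonic_def harmonic_map_def pullback_metric_def)
    obtain l where l: "smooth_map \<A> l" and
      shape: "\<And>c p v. c \<in> \<A> \<Longrightarrow> p \<in> chart_image c \<Longrightarrow>
        shape_op (sphere 0 1) (?X c) (?H c) p v = in_chart c l p *\<^sub>R frechet_derivative (?X c) (at p) v"
      using assms(7) unfolding pseudo_umbilical_def by blast
    have umb: "umbilical_immersion (?X c) (chart_image c) (in_chart c l)" if c: "c \<in> \<A>" for c
      using chart[OF c] l shape[OF c] c
      by (simp add: umbilical_immersion_def umbilical_immersion_axioms_def smooth_map_def)
    have l_const: "l m = l m'" if "m \<in> topspace T" "m' \<in> topspace T" for m m'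
    proof (rule constant_on_connected_manifold[OF M assms(4) _ _ that])
      fix c p k assume c: "c \<in> \<A>" and p: "p \<in> chart_image c"
      interpret umbilical_immersion "?X c" "chart_image c" "in_chart c l" by (rule umb[OF c])
      show "in_chart c l differentiable at p" by (rule smooth_on_imp_differentiable[OF smooth_\<mu> p])
      show "pd k (in_chart c l) p = 0" by (rule d\<mu>_eq_0[OF p bi[OF c p] assms(3)])
    qed
    define l0 where "l0 = in_chart d l p0"
    have l0: "in_chart c l p = l0" if c: "c \<in> \<A>" and p: "p \<in> chart_image c" for c p
    proof -
      obtain m m' where m: "m \<in> fst c" "snd c m = p" "m' \<in> fst d" "snd d m' = p0"
        using chart_imageE[OF p] chart_imageE[OF d(2)] by metis
      then have "in_chart c l p = l m" "l0 = l m'"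
        using in_chart_apply[OF M c] in_chart_apply[OF M d(1)] unfolding l0_def by metis+
      with m show ?thesis using l_const chart_domain(2)[OF M] c d(1) by (metis subsetD)
    qed
    have cmc: "biharmonic_cmc (?X c) (chart_image c) (in_chart c l) l0" if c: "c \<in> \<A>" for c
      using umb[OF c] l0[OF c] bi[OF c]
      by (simp add: biharmonic_cmc_def biharmonic_cmc_axioms_def)
    have l01: "l0 = 1"
    proof -
      interpret biharmonic_cmc "?X d" "chart_image d" "in_chart d l" l0 by (rule cmc[OF d(1)])
      have "H p0 \<noteq> 0" using nonharm tension_eq[OF d(2)] by auto
      then have "l0 \<noteq> 0" using H_H[OF d(2)] \<mu>_eq[OF d(2)] by auto
      then show ?thesis by (rule c_eq_1[OF d(2) dim assms(2)])
    qed
    \<comment> \<open>An arbitrary chart around each point; by chart independence \<open>F\<close>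
      has the value \<phi> + H in every chart.\<close>
    define ch where "ch m = (SOME c. c \<in> \<A> \<and> m \<in> fst c)" for m
    define F where "F m = \<phi> m + ?H (ch m) (snd (ch m) m)" for m
    have F: "in_chart c F p = ?X c p + ?H c p" if c: "c \<in> \<A>" and p: "p \<in> chart_image c" for c p
    proof -
      obtain m where m: "m \<in> fst c" "snd c m = p"
        using chart_imageE[OF p] by metis
      then have "\<exists>c. c \<in> \<A> \<and> m \<in> fst c" using c by blast
      then have "ch m \<in> \<A> \<and> m \<in> fst (ch m)" unfolding ch_def by (rule someI_ex)
      then show ?thesis
        using mean_curvature_chart_independent[OF sub c m(1)] in_chart_apply[OF M c m(1), of F] in_chart_apply[OF M c m(1), of \<phi>]
        by (simp add: F_def m(2)[symmetric])
    qed
    have F_const: "F m = F m'" if "m \<in> topspace T" "m' \<in> topspace T" for m m'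
    proof (rule constant_on_connected_manifold[OF M assms(4) _ _ that])
      fix c p k assume c: "c \<in> \<A>" and p: "p \<in> chart_image c"
      interpret biharmonic_cmc "?X c" "chart_image c" "in_chart c l" l0 by (rule cmc[OF c])
      show "in_chart c F differentiable at p"
        using differentiable_cong_open[OF open_U p F[OF c]]
          smooth_on_imp_differentiable[OF smooth_x p] smooth_on_imp_differentiable[OF smooth_H p] by simp
      have "pd k (in_chart c F) p = pd k (\<lambda>p. ?X c p + H p) p"
        by (rule pd_cong_open[OF open_U p F[OF c]])
      then show "pd k (in_chart c F) p = 0"
        using dH_eq[OF p l01]
        by (simp add: pd_add smooth_on_imp_differentiable[OF smooth_x p] smooth_on_imp_differentiable[OF smooth_H p])
    qed
    define a where "a = in_chart d F p0"
    have a: "?X c p + ?H c p = a" if c: "c \<in> \<A>" and p: "p \<in> chart_image c" for c p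
    proof -
      obtain m m' where m: "m \<in> fst c" "snd c m = p" "m' \<in> fst d" "snd d m' = p0"
        using chart_imageE[OF p] chart_imageE[OF d(2)] by metis
      then have "in_chart c F p = F m" "a = F m'"
        using in_chart_apply[OF M c] in_chart_apply[OF M d(1)] unfolding a_def by metis+
      with m show ?thesis using F_const chart_domain(2)[OF M] c d(1) F[OF c p] by (metis subsetD)
    qed
    have aX: "a \<bullet> ?X c p = 1" "a \<bullet> a = 2" if c: "c \<in> \<A>" and p: "p \<in> chart_image c" for c p
    proof -
      interpret biharmonic_cmc "?X c" "chart_image c" "in_chart c l" l0 by (rule cmc[OF c])
      show "a \<bullet> ?X c p = 1" "a \<bullet> a = 2"
        using x_x[OF p] H_x[OF p] H_H[OF p] \<mu>_eq[OF p] l01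
        by (simp_all add: a[OF c p, symmetric] inner_add_left inner_add_right inner_commute)
    qed
    have aa: "a \<bullet> a = 2" by (rule aX(2)[OF d])
    let ?S = "sphere 0 1 \<inter> {y. a \<bullet> y = 1}"
    have "\<phi> m \<in> ?S" if m: "m \<in> topspace T" for m
    proof -
      obtain c where c: "c \<in> \<A>" "m \<in> fst c" "snd c m \<in> chart_image c"
        using manifold_coverE[OF M m] by metis
      then have "a \<bullet> \<phi> m = 1" using aX(1)[OF c(1,3)] in_chart_apply[OF M c(1,2)] by metis
      then show ?thesis using sub m by (auto simp: submanifold_def)
    qed
    then have "submanifold ?S T \<A> \<phi>" using sub by (auto simp: submanifold_def)
    moreover have "minimal ?S \<A> \<phi>"
      unfolding minimal_def
    proof (intro ballI)
      fix c p assume c: "c \<in> \<A>" and p: "p \<in> chart_image c"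
      show "mean_curvature ?S (?X c) p = 0"
        using spherical_immersion.mean_curvature_hyperplane[OF chart[OF c] aa aX(1)[OF c] p] a[OF c p]
        by (simp add: algebra_simps)
    qed
    ultimately show "\<exists>S. hypersphere_of_unit_sphere (1 / sqrt 2) S \<and> submanifold S T \<A> \<phi> \<and> minimal S \<A> \<phi>"
      using hypersphere_of_unit_sphereI[OF aa] by blast
  }
  {
    assume "\<exists>S. hypersphere_of_unit_sphere (1 / sqrt 2) S \<and> submanifold S T \<A> \<phi> \<and> minimal S \<A> \<phi>"
    then obtain S where S: "hypersphere_of_unit_sphere (1 / sqrt 2) S" "submanifold S T \<A> \<phi>" "minimal S \<A> \<phi>"
      by blast
    obtain a where a: "a \<bullet> a = 2" "S = sphere 0 1 \<inter> {y. a \<bullet> y = 1}"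
      using hypersphere_normal_form[OF S(1)] dim assms(2) by (metis add_leD1 le_add1 order_trans)
    have aX: "a \<bullet> ?X c p = 1" if c: "c \<in> \<A>" and p: "p \<in> chart_image c" for c p
    proof -
      obtain m where m: "m \<in> fst c" "snd c m = p" using chart_imageE[OF p] by metis
      then have "?X c p = \<phi> m" using in_chart_apply[OF M c] by metis
      with m(1) show ?thesis using S(2) a(2) chart_domain(2)[OF M c] by (auto simp: submanifold_def)
    qed
    \<comment> \<open>Minimality in \<open>S\<close> leaves only the mean curvature of
      \<open>S\<close> itself.\<close>
    have H: "?H c p = a - ?X c p" if c: "c \<in> \<A>" and p: "p \<in> chart_image c" for c p
      using spherical_immersion.mean_curvature_hyperplane[OF chart[OF c] a(1) aX[OF c] p] S(3) c p
      unfolding minimal_def a(2) by simp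
    have "biharmonic_map (sphere 0 1) \<A> (pullback_metric \<phi>) \<phi>"
      unfolding biharmonic_map_def pullback_metric_def
      using spherical_immersion.bitension_hyperplane[OF chart H] by blast
    moreover have "\<not> harmonic_map (sphere 0 1) \<A> (pullback_metric \<phi>) \<phi>"
    proof
      assume harm: "harmonic_map (sphere 0 1) \<A> (pullback_metric \<phi>) \<phi>"
      obtain m where "m \<in> topspace T" using assms(5) by blast
      then obtain c p where c: "c \<in> \<A>" and p: "p \<in> chart_image c" using manifold_coverE[OF M] by metis
      interpret spherical_immersion "?X c" "chart_image c" by (rule chart[OF c])
      have "H p = 0"
        using harm c p tension_eq[OF p] by (auto simp: harmonic_map_def pullback_metric_def)
      \<comment> \<open>A unit vector cannot equal \<open>a\<close>, whose squared norm is
        2.\<close>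
      then have "?X c p = a" using H[OF c p] by simp
      then show False using x_x[OF p] a(1) by simp
    qed
    ultimately show "proper_biharmonic (sphere 0 1) \<A> \<phi>" by (simp add: proper_biharmonic_def)
  }
qed

end
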